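(* Assume that the finite dimensional normed space $(X,\|\cdot\|)$ and $m\in\{1,\ldots,\dim X-1\}$ have the following property: every $W\in\mathbf G_m(X)$ admits a density contractor with respect to $\mathcal H^m_{\|\cdot\|}$. Then for every complete normed Abelian group $(G,|\cdot|_G)$ the triple $\big((X,\|\cdot\|),(G,|\cdot|_G),m\big)$ satisfies the triangle inequality for cycles.
   Context: $\mathbf G_m(X)$ is the set of $m$-dimensional linear subspaces of $X$. $\mathcal H^m_{\|\cdot\|}$ is the $m$-dimensional Hausdorff measure on $X$ associated with the metric $\|x-y\|$, computed with weights $\alpha(m)2^{-m}(\mathrm{diam}\,E)^m$, where $\alpha(m)$ is the Lebesgue measure of the Euclidean unit ball of $\mathbf R^m$. $\mathrm{Hom}_m(X,X)$ is the (metric) space of linear maps $\pi:X\to X$ with $\mathrm{rank}\,\pi\le m$, and $\mathrm{Hom}(X,W)$ is the set of linear maps $\pi:X\to X$ with $\mathrm{im}\,\pi\subset W$. A density contractor on $W\in\mathbf G_m(X)$ with respect to $\mathcal H^m_{\|\cdot\|}$ is a Borel probability measure $\mu$ on $\mathrm{Hom}_m(X,X)$ such that (1) $\mu(\mathrm{Hom}_m(X,X)\setminus\mathrm{Hom}(X,W))=0$; (2) for every $V\in\mathbf G_m(X)$ and every Borel $A\subset V$, $\int_{\mathrm{Hom}_m(X,X)}\mathcal H^m_{\|\cdot\|}(\pi(A))\,d\mu(\pi)\le\mathcal H^m_{\|\cdot\|}(A)$, with equality when $V=W$. A normed Abelian group $(G,|\cdot|_G)$ satisfies $|g|_G=0$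 iff $g=0$, $|-g|_G=|g|_G$, $|g+h|_G\le|g|_G+|h|_G$; complete means complete for the metric $|g-h|_G$. $\mathcal P_m(X,G)$ is the group of polyhedral $G$ chains: (classes of) finite formal sums $\sum_k g_k[\![\sigma_k]\!]$, $g_k\in G$, $\sigma_k$ oriented $m$-simplexes in $X$, additive in the coefficients, modulo $(-g)[\![-\sigma]\!]=g[\![\sigma]\!]$ ($-\sigma$ is $\sigma$ with opposite orientation) and $g[\![\sigma]\!]=\sum_k g[\![\sigma_k]\!]$ when the $\sigma_k$ form a simplicial partition of $\sigma$ with the same orientation; $\partial:\mathcal P_m\to\mathcal P_{m-1}$ is the usual boundary, and $\mathcal M_H(\sum_kg_k[\![\sigma_k]\!])=\sum_k|g_k|_G\mathcal H^m_{\|\cdot\|}(\sigma_k)$ for nonoverlapping $\sigma_k$. Triangle inequality for cycles: whenever $\sigma_1,\ldots,\sigma_\kappa$ are oriented $m$-simplexes in $X$ and $g_1,\ldots,g_\kappa\in G$ are such that $\partial\sum_{k=1}^\kappa g_k[\![\sigma_k]\!]=0$, one has $\mathcal M_H(g_1[\![\sigma_1]\!])\le\sum_{k=2}^\kappa\mathcal M_H(g_k[\![\sigma_k]\!])$. *)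

theory Defs
  imports
    "HOL-Analysis.Analysis"
    "HOL-Probability.Probability"
    "HOL-Library.Poly_Mapping"
    "HOL-Computational_Algebra.Group_Closure"
    "Jordan_Normal_Form.Determinant"
begin

section \<open>Hausdorff measure\<close>

text \<open>
  The weight is \<open>\<alpha>(m) 2\<^sup>-\<^sup>m (diam E)\<^sup>m\<close>; \<^const>\<open>unit_ball_vol\<close> at \<open>m\<close> is the Lebesgue measure of
  the Euclidean unit ball of \<open>\<real>\<^sup>m\<close>.  The case distinction only matters for \<open>m = 0\<close>.
\<close>

definition hausdorff_weight :: "nat \<Rightarrow> 'a::metric_space set \<Rightarrow> ennreal" where
  "hausdorff_weight m E =
     (if E = {} then 0 else ennreal (unit_ball_vol (real m) / 2 ^ m * diameter E ^ m))"

text \<open>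
  \<^const>\<open>diameter\<close> is real valued and meaningless on unbounded sets, hence the boundedness
  condition on the covering sets.
\<close>

definition hausdorff_pre :: "nat \<Rightarrow> real \<Rightarrow> 'a::metric_space set \<Rightarrow> ennreal" where
  "hausdorff_pre m \<delta> A =
     (INF E \<in> {E :: nat \<Rightarrow> 'a set. A \<subseteq> (\<Union>i. E i) \<and> (\<forall>i. bounded (E i) \<and> diameter (E i) \<le> \<delta>)}.
        suminf (\<lambda>i. hausdorff_weight m (E i)))"

definition hausdorff :: "nat \<Rightarrow> 'a::metric_space set \<Rightarrow> ennreal" where
  "hausdorff m A = (SUP \<delta>\<in>{0<..}. hausdorff_pre m \<delta> A)"


section \<open>Density contractors\<close>

definition grassmannian :: "nat \<Rightarrow> 'a::real_vector set set" where
  "grassmannian m = {V. subspace V \<and> dim V = m}"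

text \<open>
  In finite dimension every linear map is bounded, so linear maps \<open>X \<rightarrow> X\<close> are the elements of
  the type of bounded linear functions, with the operator norm.
\<close>

definition Hom_rank_le :: "nat \<Rightarrow> ('a::real_normed_vector \<Rightarrow>\<^sub>L 'a) set" where
  "Hom_rank_le m = {\<pi>. dim (range (blinfun_apply \<pi>)) \<le> m}"

definition Hom_into :: "'a::real_normed_vector set \<Rightarrow> ('a \<Rightarrow>\<^sub>L 'a) set" where
  "Hom_into W = {\<pi>. range (blinfun_apply \<pi>) \<subseteq> W}"

text \<open>
  Subspaces of a finite dimensional space are closed, so the Borel subsets of \<open>V\<close> are the Borel
  sets contained in \<open>V\<close>.
\<close>

definition density_contractor ::
  "nat \<Rightarrow> 'a::real_normed_vector set \<Rightarrow> ('a \<Rightarrow>\<^sub>L 'a) measure \<Rightarrow> bool" where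
  "density_contractor m W \<mu> \<longleftrightarrow>
     prob_space \<mu> \<and>
     sets \<mu> = sets (restrict_space borel (Hom_rank_le m)) \<and>
     Hom_rank_le m - Hom_into W \<in> null_sets \<mu> \<and>
     (\<forall>V \<in> grassmannian m. \<forall>A \<in> sets borel. A \<subseteq> V \<longrightarrow>
        (\<integral>\<^sup>+\<pi>. hausdorff m (blinfun_apply \<pi> ` A) \<partial>\<mu>) \<le> hausdorff m A) \<and>
     (\<forall>A \<in> sets borel. A \<subseteq> W \<longrightarrow>
        (\<integral>\<^sup>+\<pi>. hausdorff m (blinfun_apply \<pi> ` A) \<partial>\<mu>) = hausdorff m A)"


section \<open>Complete normed Abelian groups\<close>

definition normed_ab_group :: "('g::ab_group_add \<Rightarrow> real) \<Rightarrow> bool" where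
  "normed_ab_group nrm \<longleftrightarrow>
     (\<forall>g. nrm g = 0 \<longleftrightarrow> g = 0) \<and>
     (\<forall>g. nrm (- g) = nrm g) \<and>
     (\<forall>g h. nrm (g + h) \<le> nrm g + nrm h)"

definition complete_normed_ab_group :: "('g::ab_group_add \<Rightarrow> real) \<Rightarrow> bool" where
  "complete_normed_ab_group nrm \<longleftrightarrow>
     normed_ab_group nrm \<and> Metric_space.mcomplete UNIV (\<lambda>g h. nrm (g - h))"


section \<open>Polyhedral chains\<close>

text \<open>
  An oriented \<open>m\<close>-simplex is given by the list of its \<open>m + 1\<close> affinely independent vertices, the
  order of which determines the orientation.  Lists that differ by an even permutation denote the
  same oriented simplex; they are identified by \<open>chain_relations\<close> below.
\<close>

definition oriented_simplex :: "nat \<Rightarrow> 'a::real_vector list \<Rightarrow> bool" where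
  "oriented_simplex m \<sigma> \<longleftrightarrow>
     length \<sigma> = Suc m \<and> distinct \<sigma> \<and> \<not> affine_dependent (set \<sigma>)"

abbreviation simplex_hull :: "'a::real_vector list \<Rightarrow> 'a set" where
  "simplex_hull \<sigma> \<equiv> convex hull (set \<sigma>)"

text \<open>
  \<open>edge_transition m \<sigma> \<tau> A\<close>: the matrix \<open>A\<close> expresses the edges \<open>\<tau>\<^sub>j - \<tau>\<^sub>0\<close> through the edges
  \<open>\<sigma>\<^sub>i - \<sigma>\<^sub>0\<close>.  For two \<open>m\<close>-simplexes in a common \<open>m\<close>-plane it is the unique (invertible) change
  of frame, and the sign of its determinant compares the orientations.
\<close>

definition edge_transition ::
  "nat \<Rightarrow> 'a::real_vector list \<Rightarrow> 'a list \<Rightarrow> real Matrix.mat \<Rightarrow> bool" where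
  "edge_transition m \<sigma> \<tau> A \<longleftrightarrow>
     A \<in> carrier_mat m m \<and>
     (\<forall>j<m. \<tau> ! Suc j - \<tau> ! 0 = (\<Sum>i<m. A $$ (i, j) *\<^sub>R (\<sigma> ! Suc i - \<sigma> ! 0)))"

definition same_orientation :: "nat \<Rightarrow> 'a::real_vector list \<Rightarrow> 'a list \<Rightarrow> bool" where
  "same_orientation m \<sigma> \<tau> \<longleftrightarrow> (\<exists>A. edge_transition m \<sigma> \<tau> A \<and> Determinant.det A > 0)"

definition opposite_simplex :: "nat \<Rightarrow> 'a::real_vector list \<Rightarrow> 'a list \<Rightarrow> bool" where
  "opposite_simplex m \<sigma> \<tau> \<longleftrightarrow>
     oriented_simplex m \<sigma> \<and> oriented_simplex m \<tau> \<and> set \<sigma> = set \<tau> \<and>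
     (\<exists>A. edge_transition m \<sigma> \<tau> A \<and> Determinant.det A < 0)"

definition simplicial_partition :: "nat \<Rightarrow> 'a::real_vector list \<Rightarrow> 'a list set \<Rightarrow> bool" where
  "simplicial_partition m \<sigma> T \<longleftrightarrow>
     oriented_simplex m \<sigma> \<and> finite T \<and>
     (\<forall>\<tau>\<in>T. oriented_simplex m \<tau> \<and> same_orientation m \<sigma> \<tau>) \<and>
     inj_on simplex_hull T \<and>
     (\<Union>\<tau>\<in>T. simplex_hull \<tau>) = simplex_hull \<sigma> \<and>
     (\<forall>\<tau>\<in>T. \<forall>\<tau>'\<in>T. (simplex_hull \<tau> \<inter> simplex_hull \<tau>') face_of simplex_hull \<tau>)"

text \<open>
  Formal sums \<open>\<Sum>\<^sub>k g\<^sub>k \<lbrakk>\<sigma>\<^sub>k\<rbrakk>\<close> are finitely supported maps from simplexes to coefficients, with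
  \<open>g\<lbrakk>\<sigma>\<rbrakk>\<close> being \<open>Poly_Mapping.single \<sigma> g\<close>.  The group of polyhedral chains is the group of formal
  sums of oriented \<open>m\<close>-simplexes modulo the subgroup \<open>chain_relations m\<close>.  The partitions
  consisting of one simplex identify lists that denote the same oriented simplex.
\<close>

definition chain_relations :: "nat \<Rightarrow> ('a::real_vector list \<Rightarrow>\<^sub>0 'g::ab_group_add) set" where
  "chain_relations m = group_closure
     ({Poly_Mapping.single \<tau> (- g) - Poly_Mapping.single \<sigma> g | \<sigma> \<tau> g. opposite_simplex m \<sigma> \<tau>} \<union>
      {Poly_Mapping.single \<sigma> g - (\<Sum>\<tau>\<in>T. Poly_Mapping.single \<tau> g) | \<sigma> T g.
         simplicial_partition m \<sigma> T})"

definition chain_equiv ::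
  "nat \<Rightarrow> ('a::real_vector list \<Rightarrow>\<^sub>0 'g::ab_group_add) \<Rightarrow> ('a list \<Rightarrow>\<^sub>0 'g) \<Rightarrow> bool" where
  "chain_equiv m c d \<longleftrightarrow> c - d \<in> chain_relations m"

definition simplex_boundary :: "'a list \<Rightarrow> 'g::ab_group_add \<Rightarrow> ('a list \<Rightarrow>\<^sub>0 'g)" where
  "simplex_boundary \<sigma> g =
     (\<Sum>j<length \<sigma>. Poly_Mapping.single (take j \<sigma> @ drop (Suc j) \<sigma>) (if even j then g else - g))"

definition chain_boundary :: "('a list \<Rightarrow>\<^sub>0 'g::ab_group_add) \<Rightarrow> ('a list \<Rightarrow>\<^sub>0 'g)" where
  "chain_boundary c =
     (\<Sum>\<sigma>\<in>Poly_Mapping.keys c. simplex_boundary \<sigma> (Poly_Mapping.lookup c \<sigma>))"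

text \<open>
  The Hausdorff mass of the polyhedral chain represented by a formal sum \<open>c\<close> of nonoverlapping
  simplexes.  A single term \<open>g\<lbrakk>\<sigma>\<rbrakk>\<close> is always such a sum; for overlapping simplexes the value below
  is not the mass of the class of \<open>c\<close>.
\<close>

definition hausdorff_mass ::
  "nat \<Rightarrow> ('g::ab_group_add \<Rightarrow> real) \<Rightarrow> ('a::real_normed_vector list \<Rightarrow>\<^sub>0 'g) \<Rightarrow> ennreal" where
  "hausdorff_mass m nrm c =
     (\<Sum>\<sigma>\<in>Poly_Mapping.keys c.
        ennreal (nrm (Poly_Mapping.lookup c \<sigma>)) * hausdorff m (simplex_hull \<sigma>))"

lemma simplex_boundary_zero [simp]: "simplex_boundary \<sigma> 0 = 0"
  unfolding simplex_boundary_def by (intro sum.neutral) auto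

lemma simplex_boundary_add:
  "simplex_boundary \<sigma> (g + h) = simplex_boundary \<sigma> g + simplex_boundary \<sigma> h"
  unfolding simplex_boundary_def sum.distrib [symmetric]
  by (intro sum.cong) (auto simp: single_add [symmetric])

lemma chain_boundary_single [simp]:
  "chain_boundary (Poly_Mapping.single \<sigma> g) = simplex_boundary \<sigma> g"
  by (cases "g = 0") (auto simp: chain_boundary_def)

lemma chain_boundary_add: "chain_boundary (c + d) = chain_boundary c + chain_boundary d"
proof -
  let ?K = "Poly_Mapping.keys c \<union> Poly_Mapping.keys d"
  have *: "chain_boundary e = (\<Sum>\<sigma>\<in>?K. simplex_boundary \<sigma> (Poly_Mapping.lookup e \<sigma>))"
    if "Poly_Mapping.keys e \<subseteq> ?K" for e :: "'a list \<Rightarrow>\<^sub>0 'b::ab_group_add"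
    unfolding chain_boundary_def using that
    by (intro sum.mono_neutral_left) (auto simp: in_keys_iff)
  show ?thesis
    using Poly_Mapping.keys_add [of c d]
    by (simp add: * lookup_add simplex_boundary_add sum.distrib)
qed

lemma hausdorff_mass_single:
  assumes "normed_ab_group nrm"
  shows "hausdorff_mass m nrm (Poly_Mapping.single \<sigma> g) =
    ennreal (nrm g) * hausdorff m (simplex_hull \<sigma>)"
proof -
  have "nrm 0 = 0"
    using assms by (simp add: normed_ab_group_def)
  then show ?thesis
    by (cases "g = 0") (simp_all add: hausdorff_mass_def)
qed


section \<open>The triangle inequality for cycles\<close>

text \<open>
  The condition \<open>\<partial> (\<Sum>\<^sub>k g\<^sub>k \<lbrakk>\<sigma>\<^sub>k\<rbrakk>) = 0\<close> holds in the group of polyhedral \<open>(m - 1)\<close>-chains, that is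
  up to \<open>chain_relations (m - 1)\<close>.
\<close>

definition triangle_inequality_for_cycles ::
  "'a::real_normed_vector itself \<Rightarrow> ('g::ab_group_add \<Rightarrow> real) \<Rightarrow> nat \<Rightarrow> bool" where
  "triangle_inequality_for_cycles X nrm m \<longleftrightarrow>
     (\<forall>\<kappa>\<ge>1. \<forall>(\<sigma> :: nat \<Rightarrow> 'a list) (g :: nat \<Rightarrow> 'g).
        (\<forall>k\<in>{1..\<kappa>}. oriented_simplex m (\<sigma> k)) \<longrightarrow>
        chain_equiv (m - 1) (chain_boundary (\<Sum>k=1..\<kappa>. Poly_Mapping.single (\<sigma> k) (g k))) 0 \<longrightarrow>
        hausdorff_mass m nrm (Poly_Mapping.single (\<sigma> 1) (g 1)) \<le>
          (\<Sum>k=2..\<kappa>. hausdorff_mass m nrm (Poly_Mapping.single (\<sigma> k) (g k))))"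

end

theory Submission
  imports Defs
begin

text \<open>
  Let \<open>\<sigma>\<^sub>1, \<dots>, \<sigma>\<^sub>\<kappa>\<close> carry a cycle with coefficients \<open>g\<^sub>k\<close>, and let \<open>\<mu>\<close> be a density contractor
  on the direction \<open>W\<close> of the plane of \<open>\<sigma>\<^sub>1\<close>.  The measure \<open>\<mu>\<close> lives on linear maps \<open>\<pi>\<close> of
  rank at most \<open>m\<close>, and each of them pushes the cycle to an \<open>m\<close>-dimensional cycle in a space of dimension at most \<open>m\<close>.
  Such a cycle vanishes: at almost every point the coefficients of the simplexes that cover the
  point, taken with the signs of their orientations, add up to \<open>0\<close>.  Hence
  \<open>|g\<^sub>1| 1\<^bsub>\<pi>(\<sigma>\<^sub>1)\<^esub> \<le> \<Sum>\<^sub>k\<^sub>\<ge>\<^sub>2 |g\<^sub>k| 1\<^bsub>\<pi>(\<sigma>\<^sub>k)\<^esub>\<close> almost everywhere, and integration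
  against Hausdorff measure gives \<open>|g\<^sub>1| H(\<pi>(\<sigma>\<^sub>1)) \<le> \<Sum>\<^sub>k\<^sub>\<ge>\<^sub>2 |g\<^sub>k| H(\<pi>(\<sigma>\<^sub>k))\<close>
  (\<open>triangle_inequality_image\<close>).  Integrating over \<open>\<pi>\<close> turns the left side into
  \<open>|g\<^sub>1| H(\<sigma>\<^sub>1)\<close>, because \<open>\<mu>\<close> preserves measure on \<open>W\<close>, and bounds the right side by
  \<open>\<Sum>\<^sub>k\<^sub>\<ge>\<^sub>2 |g\<^sub>k| H(\<sigma>\<^sub>k)\<close>, because \<open>\<mu>\<close> contracts on every other plane.

  The cycle condition only holds modulo subdivisions and changes of orientation, so the vanishing
  is tested by a homomorphism that does not see them.  Fix a point \<open>x\<close> of the target.  An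
  \<open>(m - 1)\<close>-simplex \<open>\<tau>\<close> is given the sign of \<open>det (\<pi> \<tau>\<^sub>0, \<dots>, \<pi> \<tau>\<^sub>m\<^sub>-\<^sub>1)\<close> if \<open>x\<close> lies in the hull
  of \<open>0\<close> and \<open>\<pi>(\<tau>)\<close>, and \<open>0\<close> otherwise; this is the intersection number of \<open>\<pi>(\<tau>)\<close> with the ray
  that leaves \<open>x\<close> in the direction away from \<open>0\<close>.  For \<open>x\<close> outside a null set this number
  respects the defining relations of chains (\<open>crossing_chain_relations\<close>), and on the boundary of
  an \<open>m\<close>-simplex \<open>\<sigma>\<close> it is the signed indicator of \<open>\<pi>(\<sigma>)\<close> (\<open>crossing_boundary\<close>).  The latter is
  an identity about the \<open>m + 2\<close> points \<open>0, \<pi> \<sigma>\<^sub>0, \<dots>, \<pi> \<sigma>\<^sub>m\<close>: the representations of \<open>x\<close> as a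
  convex combination of them form a segment in a simplex, which enters and leaves through one
  facet each, with opposite signs (\<open>line_crosses_facets_in_pairs\<close>).

  On the measure theoretic side, Hausdorff measure is shown to be a Borel measure by
  Caratheodory's criterion, hulls of at most \<open>m\<close> points are null, and \<open>H(\<pi>(K))\<close> is a Borel
  function of \<open>\<pi>\<close> for compact \<open>K\<close>, which is needed to interchange the sum over \<open>k\<close> with the
  integral over \<open>\<pi>\<close>.
\<close>

section \<open>Hausdorff measure as an outer measure\<close>

lemma hausdorff_weight_empty [simp]: "hausdorff_weight m {} = 0"
  by (simp add: hausdorff_weight_def)

lemma hausdorff_pre_le:
  assumes "A \<subseteq> (\<Union>i. E i)" "\<And>i. bounded (E i)" "\<And>i. diameter (E i) \<le> \<delta>"
  shows "hausdorff_pre m \<delta> A \<le> suminf (\<lambda>i. hausdorff_weight m (E i))"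
  unfolding hausdorff_pre_def by (rule INF_lower) (use assms in auto)

lemma hausdorff_pre_mono: "A \<subseteq> B \<Longrightarrow> hausdorff_pre m \<delta> A \<le> hausdorff_pre m \<delta> B"
  unfolding hausdorff_pre_def by (rule INF_superset_mono) auto

lemma hausdorff_pre_antimono: "\<delta> \<le> \<delta>' \<Longrightarrow> hausdorff_pre m \<delta>' A \<le> hausdorff_pre m \<delta> A"
  unfolding hausdorff_pre_def by (rule INF_superset_mono) (auto intro: order_trans)

lemma hausdorff_pre_empty: "\<delta> > 0 \<Longrightarrow> hausdorff_pre m \<delta> {} = 0"
  using hausdorff_pre_le[of "{}" "\<lambda>_. {}" \<delta> m] by simp

lemma hausdorff_pre_countably_subadditive:
  "hausdorff_pre m \<delta> (\<Union>i. A i) \<le> suminf (\<lambda>i. hausdorff_pre m \<delta> (A i))"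
proof (cases "suminf (\<lambda>i. hausdorff_pre m \<delta> (A i)) < \<top>")
  case True
  show ?thesis
  proof (rule ennreal_le_epsilon)
    fix e :: real assume e: "0 < e"
    have fin: "hausdorff_pre m \<delta> (A i) < \<top>" for i
      using True ennreal_suminf_lessD by blast
    have "\<exists>E. A i \<subseteq> (\<Union>j. E j) \<and> (\<forall>j. bounded (E j) \<and> diameter (E j) \<le> \<delta>) \<and>
        suminf (\<lambda>j. hausdorff_weight m (E j)) \<le> hausdorff_pre m \<delta> (A i) + ennreal (e * (1/2)^Suc i)" for i
    proof -
      have "hausdorff_pre m \<delta> (A i) < hausdorff_pre m \<delta> (A i) + ennreal (e * (1/2)^Suc i)"
        using fin[of i] e ennreal_add_left_cancel_less[of "hausdorff_pre m \<delta> (A i)" 0] by simp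
      then show ?thesis
        unfolding hausdorff_pre_def INF_less_iff by (force intro: less_imp_le)
    qed
    then obtain E where E: "\<And>i. A i \<subseteq> (\<Union>j. E i j)" "\<And>i j. bounded (E i j)"
      "\<And>i j. diameter (E i j) \<le> \<delta>"
      "\<And>i. suminf (\<lambda>j. hausdorff_weight m (E i j)) \<le> hausdorff_pre m \<delta> (A i) + ennreal (e * (1/2)^Suc i)"
      by metis
    let ?F = "\<lambda>n. case prod_decode n of (i, j) \<Rightarrow> E i j"
    have "(\<Union>i. A i) \<subseteq> (\<Union>n. ?F n)"
    proof
      fix x assume "x \<in> (\<Union>i. A i)"
      then obtain i j where "x \<in> E i j" using E(1) by blast
      then show "x \<in> (\<Union>n. ?F n)" by (intro UN_I[of "prod_encode (i, j)"]) auto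
    qed
    then have "hausdorff_pre m \<delta> (\<Union>i. A i) \<le> suminf (\<lambda>n. hausdorff_weight m (?F n))"
      by (rule hausdorff_pre_le) (auto split: prod.split simp: E)
    also have "\<dots> = suminf (\<lambda>n. (\<lambda>(i, j). hausdorff_weight m (E i j)) (prod_decode n))"
      by (intro arg_cong[where f = suminf]) (auto simp: fun_eq_iff split: prod.split)
    also have "\<dots> = suminf (\<lambda>i. suminf (\<lambda>j. hausdorff_weight m (E i j)))"
      by (rule suminf_ennreal_2dimen) simp
    also have "\<dots> \<le> suminf (\<lambda>i. hausdorff_pre m \<delta> (A i) + ennreal (e * (1/2)^Suc i))"
      by (intro suminf_le E summableI)
    also have "\<dots> = suminf (\<lambda>i. hausdorff_pre m \<delta> (A i)) + suminf (\<lambda>i. ennreal (e * (1/2)^Suc i))"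
      by (intro suminf_add[symmetric] summableI)
    also have "suminf (\<lambda>i. ennreal (e * (1/2)^Suc i)) = ennreal e"
      using sums_mult[OF power_half_series, of e] e
      by (intro suminf_ennreal_eq) auto
    finally show "hausdorff_pre m \<delta> (\<Union>i. A i) \<le> suminf (\<lambda>i. hausdorff_pre m \<delta> (A i)) + ennreal e" .
  qed
qed (simp add: not_less top_unique)

lemma hausdorff_pre_le_hausdorff: "0 < \<delta> \<Longrightarrow> hausdorff_pre m \<delta> A \<le> hausdorff m A"
  unfolding hausdorff_def by (rule SUP_upper) simp

lemma hausdorff_eq_SUP_seq: "hausdorff m A = (SUP n. hausdorff_pre m (1 / real (Suc n)) A)"
proof (rule antisym)
  show "hausdorff m A \<le> (SUP n. hausdorff_pre m (1 / real (Suc n)) A)"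
    unfolding hausdorff_def
  proof (rule SUP_least)
    fix \<delta> :: real assume "\<delta> \<in> {0<..}"
    then obtain n where "1 / real (Suc n) < \<delta>"
      using nat_approx_posE by auto
    then show "hausdorff_pre m \<delta> A \<le> (SUP n. hausdorff_pre m (1 / real (Suc n)) A)"
      by (intro SUP_upper2[of n] hausdorff_pre_antimono) auto
  qed
  show "(SUP n. hausdorff_pre m (1 / real (Suc n)) A) \<le> hausdorff m A"
    by (intro SUP_least hausdorff_pre_le_hausdorff) simp
qed

lemma hausdorff_empty [simp]: "hausdorff m {} = 0"
  by (simp add: hausdorff_def hausdorff_pre_empty)

lemma hausdorff_mono: "A \<subseteq> B \<Longrightarrow> hausdorff m A \<le> hausdorff m B"
  unfolding hausdorff_def by (intro SUP_mono') (rule hausdorff_pre_mono)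

lemma hausdorff_countably_subadditive: "hausdorff m (\<Union>i. A i) \<le> suminf (\<lambda>i. hausdorff m (A i))"
  unfolding hausdorff_def[of m "\<Union>i. A i"]
proof (rule SUP_least)
  fix \<delta> :: real assume "\<delta> \<in> {0<..}"
  then show "hausdorff_pre m \<delta> (\<Union>i. A i) \<le> suminf (\<lambda>i. hausdorff m (A i))"
    by (intro order_trans[OF hausdorff_pre_countably_subadditive] suminf_le summableI
        hausdorff_pre_le_hausdorff) simp
qed

lemma hausdorff_Un_le: "hausdorff m (A \<union> B) \<le> hausdorff m A + hausdorff m B"
proof -
  have "hausdorff m (A \<union> B) = hausdorff m (\<Union>i. binaryset A B i)"
    by (simp add: UN_binaryset_eq)
  also have "\<dots> \<le> suminf (\<lambda>i. hausdorff m (binaryset A B i))"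
    by (rule hausdorff_countably_subadditive)
  also have "\<dots> = hausdorff m A + hausdorff m B"
    by (rule suminf_binaryset_eq) simp
  finally show ?thesis .
qed

text \<open>
  A covering set of diameter at most \<open>\<delta>\<close> cannot meet both parts, so a cover of the union splits
  into a cover of each part.
\<close>
lemma hausdorff_pre_Un_separated:
  assumes sep: "\<And>a b. a \<in> A \<Longrightarrow> b \<in> B \<Longrightarrow> \<delta> < dist a b"
  shows "hausdorff_pre m \<delta> A + hausdorff_pre m \<delta> B \<le> hausdorff_pre m \<delta> (A \<union> B)"
  unfolding hausdorff_pre_def[of m \<delta> "A \<union> B"]
proof (rule INF_greatest, clarify)
  fix E :: "nat \<Rightarrow> 'a set"
  assume cov: "A \<union> B \<subseteq> (\<Union>i. E i)" and E: "\<forall>i. bounded (E i) \<and> diameter (E i) \<le> \<delta>"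
  define F where "F S i = (if E i \<inter> S = {} then {} else E i)" for S :: "'a set" and i
  have dpos: "0 \<le> \<delta>" using E diameter_ge_0 order_trans by blast
  have F: "hausdorff_pre m \<delta> S \<le> suminf (\<lambda>i. hausdorff_weight m (F S i))" if S: "S \<subseteq> A \<union> B" for S
  proof (rule hausdorff_pre_le)
    show "S \<subseteq> (\<Union>i. F S i)"
    proof
      fix x assume x: "x \<in> S"
      then obtain i where "x \<in> E i" using cov S x by blast
      with x show "x \<in> (\<Union>i. F S i)" by (auto simp: F_def)
    qed
  qed (use E dpos in \<open>auto simp: F_def\<close>)
  have "hausdorff_weight m (F A i) + hausdorff_weight m (F B i) \<le> hausdorff_weight m (E i)" for i
  proof -
    have "E i \<inter> A = {} \<or> E i \<inter> B = {}"
    proof (rule ccontr)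
      assume "\<not> ?thesis"
      then obtain a b where ab: "a \<in> E i" "a \<in> A" "b \<in> E i" "b \<in> B" by blast
      then have "dist a b \<le> \<delta>" using E diameter_bounded_bound order_trans by blast
      with sep ab show False by fastforce
    qed
    then show ?thesis by (auto simp: F_def)
  qed
  then have "suminf (\<lambda>i. hausdorff_weight m (F A i) + hausdorff_weight m (F B i))
      \<le> suminf (\<lambda>i. hausdorff_weight m (E i))"
    by (intro suminf_le summableI)
  then show "hausdorff_pre m \<delta> A + hausdorff_pre m \<delta> B \<le> suminf (\<lambda>i. hausdorff_weight m (E i))"
    using F[of A] F[of B]
    by (subst (asm) suminf_add[symmetric]) (auto intro: add_mono order_trans)
qed

lemma hausdorff_Un_separated:
  assumes r: "0 < r" and sep: "\<And>a b. a \<in> A \<Longrightarrow> b \<in> B \<Longrightarrow> r \<le> dist a b"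
  shows "hausdorff m (A \<union> B) = hausdorff m A + hausdorff m B"
proof (rule antisym[OF hausdorff_Un_le])
  have inc: "incseq (\<lambda>n. hausdorff_pre m (1 / real (Suc n)) S)" for S :: "'a set"
    by (intro incseq_SucI hausdorff_pre_antimono) (simp add: field_simps)
  have "hausdorff m A + hausdorff m B =
      (SUP n. hausdorff_pre m (1 / real (Suc n)) A + hausdorff_pre m (1 / real (Suc n)) B)"
    unfolding hausdorff_eq_SUP_seq by (intro ennreal_SUP_add[symmetric] inc)
  also have "\<dots> \<le> hausdorff m (A \<union> B)"
  proof (rule SUP_least)
    fix n
    obtain k where k: "1 / real (Suc k) < r"
      using nat_approx_posE[OF r] by auto
    \<comment> \<open>The scale must be finer than the gap and not coarser than the given one.\<close>
    let ?d = "1 / real (Suc (max n k))"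
    have "?d \<le> 1 / real (Suc n)" "?d \<le> 1 / real (Suc k)"
      by (auto intro!: divide_left_mono)
    then have "hausdorff_pre m (1 / real (Suc n)) A + hausdorff_pre m (1 / real (Suc n)) B
        \<le> hausdorff_pre m ?d A + hausdorff_pre m ?d B"
      by (intro add_mono hausdorff_pre_antimono)
    also have "\<dots> \<le> hausdorff_pre m ?d (A \<union> B)"
      using sep k \<open>?d \<le> 1 / real (Suc k)\<close> by (intro hausdorff_pre_Un_separated) force
    also have "\<dots> \<le> hausdorff m (A \<union> B)"
      by (rule hausdorff_pre_le_hausdorff) simp
    finally show "hausdorff_pre m (1 / real (Suc n)) A + hausdorff_pre m (1 / real (Suc n)) B
        \<le> hausdorff m (A \<union> B)" .
  qed
  finally show "hausdorff m A + hausdorff m B \<le> hausdorff m (A \<union> B)" .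
qed

section \<open>Borel sets are measurable for Hausdorff measure\<close>

text \<open>
  The part \<open>D n\<close> of \<open>A\<close> at distance at least \<open>1/(n+1)\<close> from \<open>C\<close> is separated from \<open>A \<inter> C\<close>, so only
  \<open>hausdorff m (D n) \<longrightarrow> hausdorff m (A - C)\<close> is at stake.  The shells \<open>R n\<close> between \<open>D n\<close> and
  \<open>D (n + 1)\<close> cover what is missing; shells whose indices differ by at least \<open>2\<close> are separated, so
  the measures of the shells of either parity add up to at most \<open>hausdorff m A\<close>, and the tail of the
  series tends to \<open>0\<close>.
\<close>
lemma hausdorff_Caratheodory_closed:
  assumes C: "closed C"
  shows "hausdorff m (A \<inter> C) + hausdorff m (A - C) \<le> hausdorff m A"
proof (cases "C = {} \<or> hausdorff m A = \<top>")
  case False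
  then have C0: "C \<noteq> {}" and fin: "hausdorff m A \<noteq> \<top>" by auto
  define D where "D n = {x \<in> A. 1 / real (Suc n) \<le> infdist x C}" for n
  define R where "R n = D (Suc n) - D n" for n
  have D_sub: "D n \<subseteq> A" for n by (auto simp: D_def)
  have lip: "infdist x C - infdist y C \<le> dist x y" for x y
    using infdist_triangle[of x C y] by (simp add: algebra_simps)
  have parity: "(\<Sum>k<n. hausdorff m (R (2 * k + i))) \<le> hausdorff m A" for n i
  proof -
    have "(\<Sum>k<n. hausdorff m (R (2 * k + i))) = hausdorff m (\<Union>k<n. R (2 * k + i))"
    proof (induction n)
      case (Suc n)
      have "hausdorff m ((\<Union>k<n. R (2 * k + i)) \<union> R (2 * n + i)) =
          hausdorff m (\<Union>k<n. R (2 * k + i)) + hausdorff m (R (2 * n + i))"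
      proof (rule hausdorff_Un_separated)
        let ?N = "real (2 * n + i)"
        have "1 / (?N + 1) < 1 / ?N" if "n > 0"
          using that by (intro divide_strict_left_mono) auto
        \<comment> \<open>The gap between shell \<open>2n + i\<close> and the earlier ones of the same parity; for \<open>n = 0\<close> there are
          none and any positive number will do.\<close>
        then show "0 < (if n = 0 then 1 else 1 / ?N - 1 / (?N + 1))" by simp
        fix a b assume a: "a \<in> (\<Union>k<n. R (2 * k + i))" and b: "b \<in> R (2 * n + i)"
        from a obtain k where k: "k < n" "1 / real (Suc (Suc (2 * k + i))) \<le> infdist a C"
          by (auto simp: R_def D_def)
        have "1 / ?N \<le> 1 / real (Suc (Suc (2 * k + i)))"
          using k(1) by (intro divide_left_mono) auto
        moreover have "infdist b C < 1 / (?N + 1)"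
          using b by (auto simp: R_def D_def add.commute)
        ultimately show "(if n = 0 then 1 else 1 / ?N - 1 / (?N + 1)) \<le> dist a b"
          using lip[of a b] k by auto
      qed
      then show ?case using Suc by (simp add: lessThan_Suc Un_commute)
    qed simp
    also have "\<dots> \<le> hausdorff m A"
      by (rule hausdorff_mono) (auto simp: R_def D_def)
    finally show ?thesis .
  qed
  let ?S = "suminf (\<lambda>k. hausdorff m (R k))"
  have "?S \<le> hausdorff m A + hausdorff m A"
  proof (rule suminf_le_const[OF summableI])
    fix n
    have "(\<Sum>k<n. hausdorff m (R k)) \<le> (\<Sum>k<2 * n. hausdorff m (R k))"
      by (intro sum_mono2) auto
    also have "\<dots> = (\<Sum>k<n. hausdorff m (R (2 * k + 0))) + (\<Sum>k<n. hausdorff m (R (2 * k + 1)))"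
      by (induction n) (simp_all add: algebra_simps)
    also have "\<dots> \<le> hausdorff m A + hausdorff m A"
      by (intro add_mono parity)
    finally show "(\<Sum>k<n. hausdorff m (R k)) \<le> hausdorff m A + hausdorff m A" .
  qed
  then have S: "?S \<noteq> \<top>"
    using fin by (auto simp: top_unique)
  have cover: "A - C \<subseteq> D n \<union> (\<Union>k. R (k + n))" for n
  proof
    fix x assume x: "x \<in> A - C"
    then have "0 < infdist x C"
      using C C0 in_closed_iff_infdist_zero[of C x] infdist_nonneg[of x C] by auto
    then obtain j where j: "1 / real (Suc j) < infdist x C"
      using nat_approx_posE by auto
    then have "x \<in> D j" using x by (auto simp: D_def)
    then have "\<exists>l. x \<in> D l" by blast
    define l where "l = (LEAST l. x \<in> D l)"
    have l: "x \<in> D l" using \<open>\<exists>l. x \<in> D l\<close> unfolding l_def by (rule LeastI_ex)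
    have l': "x \<notin> D k" if "k < l" for k using that not_less_Least unfolding l_def by blast
    show "x \<in> D n \<union> (\<Union>k. R (k + n))"
    proof (cases "x \<in> D n")
      case False
      have "n < l"
      proof (rule ccontr)
        assume "\<not> n < l"
        then have "1 / real (Suc n) \<le> 1 / real (Suc l)" by (intro divide_left_mono) auto
        with l False show False by (auto simp: D_def)
      qed
      then obtain k where "l = Suc (k + n)"
        by (metis add.commute less_iff_Suc_add)
      then have "x \<in> R (k + n)" using l l'[of "k + n"] by (auto simp: R_def)
      then show ?thesis by blast
    qed simp
  qed
  have tail: "hausdorff m (A - C) + (\<Sum>k<n. hausdorff m (R k)) \<le> hausdorff m (D n) + ?S" for n
  proof -
    have "hausdorff m (A - C) \<le> hausdorff m (D n) + suminf (\<lambda>k. hausdorff m (R (k + n)))"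
      by (rule order_trans[OF hausdorff_mono[OF cover] order_trans[OF hausdorff_Un_le
            add_left_mono[OF hausdorff_countably_subadditive]]])
    then have "hausdorff m (A - C) + (\<Sum>k<n. hausdorff m (R k)) \<le>
        hausdorff m (D n) + suminf (\<lambda>k. hausdorff m (R (k + n))) + (\<Sum>k<n. hausdorff m (R k))"
      by (rule add_right_mono)
    also have "\<dots> = hausdorff m (D n) + ?S"
      by (subst suminf_offset[of _ n]) (simp_all add: add.assoc)
    finally show ?thesis .
  qed
  have sep: "hausdorff m (A \<inter> C) + hausdorff m (D n) \<le> hausdorff m A" for n
  proof -
    have "hausdorff m ((A \<inter> C) \<union> D n) = hausdorff m (A \<inter> C) + hausdorff m (D n)"
    proof (rule hausdorff_Un_separated)
      show "0 < 1 / real (Suc n)" by simp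
      show "1 / real (Suc n) \<le> dist a b" if "a \<in> A \<inter> C" "b \<in> D n" for a b
        using that infdist_le[of a C b] by (auto simp: D_def dist_commute)
    qed
    then show ?thesis
      using hausdorff_mono[of "(A \<inter> C) \<union> D n" A m] D_sub by auto
  qed
  have "hausdorff m (A \<inter> C) + hausdorff m (A - C) + ?S \<le> hausdorff m A + ?S"
  proof (rule LIMSEQ_le_const2)
    show "(\<lambda>n. hausdorff m (A \<inter> C) + hausdorff m (A - C) + (\<Sum>k<n. hausdorff m (R k)))
        \<longlonglongrightarrow> hausdorff m (A \<inter> C) + hausdorff m (A - C) + ?S"
      by (intro tendsto_add tendsto_const summable_LIMSEQ summableI)
    have "hausdorff m (A \<inter> C) + hausdorff m (A - C) + (\<Sum>k<n. hausdorff m (R k))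
        \<le> hausdorff m A + ?S" for n
    proof -
      have "hausdorff m (A \<inter> C) + (hausdorff m (A - C) + (\<Sum>k<n. hausdorff m (R k)))
          \<le> hausdorff m (A \<inter> C) + (hausdorff m (D n) + ?S)"
        by (rule add_left_mono[OF tail])
      also have "\<dots> = (hausdorff m (A \<inter> C) + hausdorff m (D n)) + ?S"
        by (simp only: add.assoc)
      also have "\<dots> \<le> hausdorff m A + ?S"
        by (rule add_right_mono[OF sep])
      finally show ?thesis by (simp only: add.assoc)
    qed
    then show "\<exists>N. \<forall>n\<ge>N. hausdorff m (A \<inter> C) + hausdorff m (A - C) + (\<Sum>k<n. hausdorff m (R k))
        \<le> hausdorff m A + ?S" by blast
  qed
  then show ?thesis
    using S by (simp add: add.commute[of _ ?S] ennreal_add_left_cancel_le)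
qed (auto simp: top_unique)

definition hausdorff_measure :: "nat \<Rightarrow> 'a::metric_space measure" where
  "hausdorff_measure m = measure_of UNIV (sets borel) (hausdorff m)"

lemma space_hausdorff_measure [simp]: "space (hausdorff_measure m) = UNIV"
  by (simp add: hausdorff_measure_def)

lemma sets_hausdorff_measure [simp, measurable_cong]: "sets (hausdorff_measure m) = sets borel"
  unfolding hausdorff_measure_def
  by (metis sets.sigma_sets_eq sets_measure_of space_borel subset_Pow_Union top_greatest Pow_UNIV)

lemma emeasure_hausdorff_measure:
  assumes A: "A \<in> sets borel"
  shows "emeasure (hausdorff_measure m) A = hausdorff m A"
proof -
  let ?L = "lambda_system UNIV UNIV (hausdorff m :: 'a set \<Rightarrow> ennreal)"
  interpret P: sigma_algebra "UNIV :: 'a set" "UNIV :: 'a set set"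
    using sigma_algebra_Pow[of "UNIV :: 'a set"] by simp
  have "outer_measure_space UNIV (hausdorff m :: 'a set \<Rightarrow> ennreal)"
    unfolding outer_measure_space_def positive_def increasing_def countably_subadditive_def
    by (auto intro: hausdorff_mono hausdorff_countably_subadditive)
  then have ms: "measure_space UNIV ?L (hausdorff m)"
    by (rule P.caratheodory_lemma)
  then interpret L: sigma_algebra UNIV ?L
    by (simp add: measure_space_def)
  have "C \<in> ?L" if "closed C" for C :: "'a set"
    unfolding lambda_system_def
  proof (clarsimp, rule antisym)
    fix S :: "'a set"
    show "hausdorff m (C \<inter> S) + hausdorff m ((UNIV - C) \<inter> S) \<le> hausdorff m S"
      using hausdorff_Caratheodory_closed[OF that, of m S]
      by (simp add: Int_commute Diff_eq)
    have "hausdorff m S = hausdorff m ((C \<inter> S) \<union> ((UNIV - C) \<inter> S))"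
      by (rule arg_cong[where f = "hausdorff m"]) auto
    then show "hausdorff m S \<le> hausdorff m (C \<inter> S) + hausdorff m ((UNIV - C) \<inter> S)"
      using hausdorff_Un_le by simp
  qed
  then have "sets borel \<subseteq> ?L"
    unfolding borel_eq_closed by (subst sets_measure_of) (auto intro!: L.sigma_sets_subset)
  then have "measure_space UNIV (sets borel) (hausdorff m :: 'a set \<Rightarrow> ennreal)"
    using measure_down[OF ms] sets.sigma_algebra_axioms[of "borel :: 'a measure"] by simp
  then show ?thesis
    using A unfolding hausdorff_measure_def measure_space_def
    by (intro emeasure_measure_of_sigma) auto
qed

text \<open>
  Isometries carry covers to covers with the same diameters; translations are the case of interest.
\<close>
lemma hausdorff_isometric_image_le:
  fixes f :: "'a::metric_space \<Rightarrow> 'b::metric_space"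
  assumes f: "\<And>x y. dist (f x) (f y) = dist x y"
  shows "hausdorff m (f ` A) \<le> hausdorff m A"
  unfolding hausdorff_def
proof (rule SUP_mono')
  fix \<delta> :: real
  have d: "diameter (f ` S) = diameter S" for S
  proof -
    have "(f ` S) \<times> (f ` S) = map_prod f f ` (S \<times> S)" by auto
    then show ?thesis by (simp add: diameter_def image_image case_prod_unfold f)
  qed
  show "hausdorff_pre m \<delta> (f ` A) \<le> hausdorff_pre m \<delta> A"
    unfolding hausdorff_pre_def[of m \<delta> A]
  proof (rule INF_greatest, clarify)
    fix E :: "nat \<Rightarrow> 'a set" assume E: "A \<subseteq> (\<Union>i. E i)" "\<forall>i. bounded (E i) \<and> diameter (E i) \<le> \<delta>"
    have b: "bounded (f ` E i)" for i
      using E(2) by (auto simp: bounded_two_points f)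
    have "hausdorff_pre m \<delta> (f ` A) \<le> suminf (\<lambda>i. hausdorff_weight m (f ` E i))"
    proof (rule hausdorff_pre_le)
      show "f ` A \<subseteq> (\<Union>i. f ` E i)" using E(1) by blast
    qed (use E b in \<open>auto simp: d\<close>)
    then show "hausdorff_pre m \<delta> (f ` A) \<le> suminf (\<lambda>i. hausdorff_weight m (E i))"
      by (simp only: hausdorff_weight_def d image_is_empty)
  qed
qed

lemma hausdorff_translation:
  fixes a :: "'a::real_normed_vector"
  shows "hausdorff m ((+) a ` A) = hausdorff m A"
proof (rule antisym)
  show "hausdorff m ((+) a ` A) \<le> hausdorff m A"
    by (rule hausdorff_isometric_image_le) (simp add: dist_norm)
  have "hausdorff m ((+) (- a) ` (+) a ` A) \<le> hausdorff m ((+) a ` A)"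
    by (rule hausdorff_isometric_image_le) (simp add: dist_norm)
  then show "hausdorff m A \<le> hausdorff m ((+) a ` A)" by (simp add: image_image)
qed

section \<open>Hulls of few points are null\<close>

lemma hausdorff_pre_le_sum:
  assumes I: "finite I" and "A \<subseteq> (\<Union>i\<in>I. E i)"
    and E: "\<And>i. i \<in> I \<Longrightarrow> bounded (E i)" "\<And>i. i \<in> I \<Longrightarrow> diameter (E i) \<le> \<delta>" and "0 \<le> \<delta>"
  shows "hausdorff_pre m \<delta> A \<le> (\<Sum>i\<in>I. hausdorff_weight m (E i))"
proof -
  obtain h where h: "bij_betw h {..<card I} I"
    using ex_bij_betw_nat_finite[OF I] by (auto simp: atLeast0LessThan)
  define F where "F n = (if n < card I then E (h n) else {})" for n
  have hI: "h n \<in> I" if "n < card I" for n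
    using h that by (auto simp: bij_betw_def)
  have "A \<subseteq> (\<Union>n. F n)"
  proof
    fix x assume "x \<in> A"
    then obtain i where i: "i \<in> I" "x \<in> E i" using assms by blast
    then obtain n where "n < card I" "i = h n" using h by (auto simp: bij_betw_def)
    then show "x \<in> (\<Union>n. F n)" using i by (auto simp: F_def)
  qed
  then have "hausdorff_pre m \<delta> A \<le> suminf (\<lambda>n. hausdorff_weight m (F n))"
    by (rule hausdorff_pre_le) (auto simp: F_def E hI \<open>0 \<le> \<delta>\<close>)
  also have "\<dots> = (\<Sum>n<card I. hausdorff_weight m (E (h n)))"
    by (subst suminf_finite[of "{..<card I}"]) (auto simp: F_def)
  also have "\<dots> = (\<Sum>i\<in>I. hausdorff_weight m (E i))"
    by (rule sum.reindex_bij_betw[OF h])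
  finally show ?thesis .
qed

lemma hausdorff_eq_0I:
  assumes "\<And>\<delta> \<epsilon>. 0 < \<delta> \<Longrightarrow> 0 < \<epsilon> \<Longrightarrow> hausdorff_pre m \<delta> A \<le> ennreal \<epsilon>"
  shows "hausdorff m A = 0"
proof -
  have "hausdorff_pre m \<delta> A \<le> 0" if "0 < \<delta>" for \<delta>
    by (rule ennreal_le_epsilon) (use assms that in simp)
  then show ?thesis
    unfolding hausdorff_def by (auto intro!: antisym SUP_least)
qed

text \<open>
  With one point \<open>q\<close> of \<open>S\<close> as origin, the hull is parametrised by the at most \<open>m - 1\<close> barycentric
  coordinates of the other points.  Cutting each of them into \<open>N\<close> steps gives at most
  \<open>(N + 1)\<^sup>m\<^sup>-\<^sup>1\<close> cells of diameter \<open>O(1/N)\<close>, whose total weight is \<open>O(1/N)\<close>.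
\<close>
lemma hausdorff_hull_null:
  fixes S :: "'a::real_normed_vector set"
  assumes S: "finite S" "card S \<le> m" and m: "1 \<le> m"
  shows "hausdorff m (convex hull S) = 0"
proof (cases "S = {}")
  case False
  then obtain q where q: "q \<in> S" by blast
  define R where "R = S - {q}"
  have R: "finite R" "card R \<le> m - 1" "S = insert q R" "q \<notin> R"
    using S q by (auto simp: R_def card_Diff_singleton)
  \<comment> \<open>The summand \<open>1\<close> only makes \<open>C\<close> positive when \<open>R\<close> is empty.\<close>
  define C where "C = (\<Sum>p\<in>R. norm (p - q)) + 1"
  have C: "0 < C" unfolding C_def by (smt (verit) sum_nonneg norm_ge_zero)
  define K where "K = unit_ball_vol (real m) / 2 ^ m * C ^ m * 2 ^ (m - 1)"
  have K: "0 \<le> K" using C by (simp add: K_def)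
  have bound: "hausdorff_pre m \<delta> (convex hull S) \<le> ennreal (K / real N)"
    if N: "1 \<le> N" "C / real N \<le> \<delta>" for N \<delta>
  proof -
    define I where "I = PiE R (\<lambda>_. {0..N})"
    define E where "E f = {q + (\<Sum>p\<in>R. u p *\<^sub>R (p - q)) | u.
        \<forall>p\<in>R. real (f p) \<le> real N * u p \<and> real N * u p \<le> real (f p) + 1}" for f :: "'a \<Rightarrow> nat"
    have N0: "0 < real N" using N by simp
    have dE: "dist x y \<le> C / real N" if xy: "x \<in> E f" "y \<in> E f" for x y f
    proof -
      obtain u v where u: "x = q + (\<Sum>p\<in>R. u p *\<^sub>R (p - q))"
          "\<forall>p\<in>R. real (f p) \<le> real N * u p \<and> real N * u p \<le> real (f p) + 1"
        and v: "y = q + (\<Sum>p\<in>R. v p *\<^sub>R (p - q))"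
          "\<forall>p\<in>R. real (f p) \<le> real N * v p \<and> real N * v p \<le> real (f p) + 1"
        using xy unfolding E_def by blast
      have "x - y = (\<Sum>p\<in>R. (u p - v p) *\<^sub>R (p - q))"
        by (simp add: u v sum_subtractf scaleR_left_diff_distrib)
      then have "dist x y \<le> (\<Sum>p\<in>R. \<bar>u p - v p\<bar> * norm (p - q))"
        unfolding dist_norm by (simp add: norm_sum[THEN order_trans])
      also have "\<dots> \<le> (\<Sum>p\<in>R. 1 / real N * norm (p - q))"
      proof (intro sum_mono mult_right_mono)
        fix p assume "p \<in> R"
        then have "\<bar>real N * u p - real N * v p\<bar> \<le> 1"
          using u(2) v(2) by (smt (verit))
        then have "real N * \<bar>u p - v p\<bar> \<le> 1"
          using N0 by (simp flip: right_diff_distrib add: abs_mult)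
        then show "\<bar>u p - v p\<bar> \<le> 1 / real N" using N0 by (simp add: field_simps)
      qed simp
      also have "\<dots> \<le> C / real N"
        using N0 by (simp add: C_def sum_divide_distrib[symmetric] divide_right_mono)
      finally show ?thesis .
    qed
    have bE: "bounded (E f)" for f
      unfolding bounded_two_points using dE by blast
    have diamE: "diameter (E f) \<le> C / real N" for f
      using dE C N0 by (intro diameter_le) (auto simp: dist_norm)
    have cov: "convex hull S \<subseteq> (\<Union>f\<in>I. E f)"
    proof
      fix x assume "x \<in> convex hull S"
      then obtain u where u: "\<forall>p\<in>S. 0 \<le> u p" "sum u S = 1" "(\<Sum>p\<in>S. u p *\<^sub>R p) = x"
        using S(1) by (auto simp: convex_hull_finite)
      have u1: "u p \<le> 1" if "p \<in> S" for p
        using u(1,2) S(1) that member_le_sum[of p S u] by auto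
      have uq: "u q = 1 - sum u R" using u(2) R by simp
      have xq: "x = u q *\<^sub>R q + (\<Sum>p\<in>R. u p *\<^sub>R p)"
        using u(3) R(1,4) unfolding R(3) by simp
      have x: "x = q + (\<Sum>p\<in>R. u p *\<^sub>R (p - q))"
        unfolding xq uq by (simp add: scaleR_left_diff_distrib scaleR_right_diff_distrib
            sum_subtractf scaleR_sum_left)
      define f where "f = restrict (\<lambda>p. nat \<lfloor>real N * u p\<rfloor>) R"
      have f: "real (f p) \<le> real N * u p \<and> real N * u p \<le> real (f p) + 1 \<and> f p \<le> N" if p: "p \<in> R" for p
      proof -
        have "0 \<le> real N * u p" "real N * u p \<le> real N"
          using u(1) u1[of p] p R(3) by (auto intro: mult_left_le)
        then show ?thesis using p by (simp add: f_def) linarith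
      qed
      then have "x \<in> E f" unfolding E_def using x by blast
      moreover have "f \<in> I" using f by (auto simp: I_def f_def)
      ultimately show "x \<in> (\<Union>f\<in>I. E f)" by blast
    qed
    have finI: "finite I" unfolding I_def using R by (intro finite_PiE) auto
    have "card I = (N + 1) ^ card R"
      unfolding I_def using R by (simp add: card_PiE)
    also have "\<dots> \<le> (2 * N) ^ (m - 1)"
      using N R by (intro order_trans[OF power_increasing[OF R(2)] power_mono]) auto
    finally have cI: "real (card I) \<le> (2 * real N) ^ (m - 1)"
      by (metis of_nat_le_iff of_nat_mult of_nat_numeral of_nat_power)
    have "0 \<le> C / real N" using C N0 by simp
    then have "hausdorff_pre m \<delta> (convex hull S) \<le> (\<Sum>f\<in>I. hausdorff_weight m (E f))"
      using N(2) by (intro hausdorff_pre_le_sum finI cov bE order_trans[OF diamE]) auto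
    also have "\<dots> \<le> (\<Sum>f\<in>I. ennreal (unit_ball_vol (real m) / 2 ^ m * (C / real N) ^ m))"
    proof (rule sum_mono)
      fix f
      have "unit_ball_vol (real m) / 2 ^ m * diameter (E f) ^ m
          \<le> unit_ball_vol (real m) / 2 ^ m * (C / real N) ^ m"
        using diamE diameter_ge_0[OF bE] by (intro mult_left_mono power_mono) auto
      then show "hausdorff_weight m (E f) \<le> ennreal (unit_ball_vol (real m) / 2 ^ m * (C / real N) ^ m)"
        unfolding hausdorff_weight_def by (auto intro: ennreal_leI)
    qed
    also have "\<dots> = ennreal (real (card I) * (unit_ball_vol (real m) / 2 ^ m * (C / real N) ^ m))"
      using C N0 by (subst ennreal_mult'') (auto simp: ennreal_of_nat_eq_real_of_nat)
    also have "\<dots> \<le> ennreal (K / real N)"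
    proof (rule ennreal_leI)
      have "real (card I) * (unit_ball_vol (real m) / 2 ^ m * (C / real N) ^ m)
          \<le> (2 * real N) ^ (m - 1) * (unit_ball_vol (real m) / 2 ^ m * (C / real N) ^ m)"
        using C N0 by (intro mult_right_mono cI) auto
      also have "\<dots> = K / real N"
      proof -
        have "(C / real N) ^ m = C ^ m / (real N ^ (m - 1) * real N)"
          using m power_Suc2[of "real N" "m - 1"] by (simp add: power_divide)
        then show ?thesis using N0 by (simp add: K_def power_mult_distrib)
      qed
      finally show "real (card I) * (unit_ball_vol (real m) / 2 ^ m * (C / real N) ^ m) \<le> K / real N" .
    qed
    finally show ?thesis .
  qed
  show ?thesis
  proof (rule hausdorff_eq_0I)
    fix \<delta> \<epsilon> :: real assume pos: "0 < \<delta>" "0 < \<epsilon>"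
    define N where "N = nat \<lceil>C / \<delta> + K / \<epsilon>\<rceil> + 1"
    have "C / \<delta> + K / \<epsilon> \<le> real N" unfolding N_def by linarith
    moreover have "0 \<le> C / \<delta>" "0 \<le> K / \<epsilon>" using pos C K by auto
    ultimately have "C / \<delta> \<le> real N" "K / \<epsilon> \<le> real N" by linarith+
    moreover have N: "0 < real N" by (simp add: N_def)
    ultimately have "C / real N \<le> \<delta>" "K / real N \<le> \<epsilon>"
      using pos by (simp_all add: field_simps)
    then show "hausdorff_pre m \<delta> (convex hull S) \<le> ennreal \<epsilon>"
      using bound[of N \<delta>] N by (auto intro: order_trans ennreal_leI)
  qed
qed simp

section \<open>Hausdorff measure of the image of a compact set\<close>

text \<open>
  A cover of a compact set by open sets also covers all nearby sets, so that this variant of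
  \<^const>\<open>hausdorff_pre\<close> is visibly upper semicontinuous on compact sets.
\<close>
definition open_content :: "nat \<Rightarrow> real \<Rightarrow> 'a::metric_space set \<Rightarrow> ennreal" where
  "open_content m \<delta> A =
     (INF E \<in> {E :: nat \<Rightarrow> 'a set. A \<subseteq> (\<Union>i. E i) \<and> (\<forall>i. open (E i) \<and> bounded (E i) \<and> diameter (E i) \<le> \<delta>)}.
        suminf (\<lambda>i. hausdorff_weight m (E i)))"

lemma open_enlargement:
  fixes S :: "'a::metric_space set"
  assumes S: "bounded S" "diameter S \<le> \<delta>" and pos: "0 < \<delta>" "0 < \<epsilon>"
  shows "\<exists>U. open U \<and> S \<subseteq> U \<and> bounded U \<and> diameter U \<le> 2 * \<delta> \<and>
    hausdorff_weight m U \<le> hausdorff_weight m S + ennreal \<epsilon>"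
proof (cases "S = {}")
  case True
  then show ?thesis using pos by (intro exI[of _ "{}"]) auto
next
  case False
  let ?w = "\<lambda>d. unit_ball_vol (real m) / 2 ^ m * d ^ m"
  have "((\<lambda>r. ?w (diameter S + 2 * r)) \<longlongrightarrow> ?w (diameter S + 2 * 0)) (at_right 0)"
    by (intro tendsto_intros)
  then have "\<forall>\<^sub>F r in at_right 0. ?w (diameter S + 2 * r) < ?w (diameter S) + \<epsilon>"
    using pos by (intro order_tendstoD(2)) auto
  moreover have "\<forall>\<^sub>F r in at_right 0. r < \<delta> / 2"
    using pos by (intro order_tendstoD(2)[OF tendsto_ident_at]) auto
  moreover have "\<forall>\<^sub>F r::real in at_right 0. 0 < r"
    by (simp add: eventually_at_right_less)
  ultimately have "\<forall>\<^sub>F r in at_right 0. 0 < r \<and> r < \<delta> / 2 \<and> ?w (diameter S + 2 * r) < ?w (diameter S) + \<epsilon>"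
    by eventually_elim auto
  then obtain r where r: "0 < r" "r < \<delta> / 2" "?w (diameter S + 2 * r) < ?w (diameter S) + \<epsilon>"
    using eventually_happens'[OF trivial_limit_at_right_real] by blast
  let ?U = "\<Union>x\<in>S. ball x r"
  have d: "dist x y \<le> diameter S + 2 * r" if "x \<in> ?U" "y \<in> ?U" for x y
  proof -
    obtain a b where ab: "a \<in> S" "dist a x < r" "b \<in> S" "dist b y < r" using \<open>x \<in> ?U\<close> \<open>y \<in> ?U\<close> by auto
    have "dist a b \<le> diameter S" using S ab by (intro diameter_bounded_bound) auto
    then show ?thesis using ab(2,4) dist_triangle[of x y a] dist_triangle[of a y b] by (simp add: dist_commute)
  qed
  have ne: "?U \<noteq> {}" using False r by auto
  have bU: "bounded ?U" unfolding bounded_two_points using d by blast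
  have dU: "diameter ?U \<le> diameter S + 2 * r"
  proof -
    define V where "V = ?U"
    have V: "V \<noteq> {}" "\<And>x y. x \<in> V \<Longrightarrow> y \<in> V \<Longrightarrow> dist x y \<le> diameter S + 2 * r"
      unfolding V_def by (rule ne, rule d)
    have "(SUP (x, y)\<in>V \<times> V. dist x y) \<le> diameter S + 2 * r"
      using V by (intro cSUP_least) auto
    then have "diameter V \<le> diameter S + 2 * r"
      using V(1) by (simp add: diameter_def[of V])
    then show ?thesis by (simp only: V_def)
  qed
  show ?thesis
  proof (intro exI[of _ ?U] conjI)
    have "ennreal (?w (diameter ?U)) \<le> ennreal (?w (diameter S) + \<epsilon>)"
    proof (rule ennreal_leI)
      have "?w (diameter ?U) \<le> ?w (diameter S + 2 * r)"
        using dU diameter_ge_0[OF bU] by (intro mult_left_mono power_mono) auto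
      then show "?w (diameter ?U) \<le> ?w (diameter S) + \<epsilon>" using r by linarith
    qed
    also have "\<dots> = ennreal (?w (diameter S)) + ennreal \<epsilon>"
      using pos diameter_ge_0[OF S(1)] by (intro ennreal_plus) auto
    finally show "hausdorff_weight m ?U \<le> hausdorff_weight m S + ennreal \<epsilon>"
      using ne False unfolding hausdorff_weight_def by (simp only: if_False)
  qed (use r dU S bU in auto)
qed

text \<open>
  Passing from arbitrary to open covering sets costs a factor \<open>2\<close> in the scale, which disappears in
  the supremum.
\<close>
lemma hausdorff_eq_SUP_open_content:
  "hausdorff m A = (SUP n. open_content m (1 / real (Suc n)) A)"
proof (rule antisym)
  have "hausdorff_pre m \<delta> A \<le> open_content m \<delta> A" for \<delta>
    unfolding hausdorff_pre_def open_content_def by (rule INF_superset_mono) auto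
  then show "hausdorff m A \<le> (SUP n. open_content m (1 / real (Suc n)) A)"
    unfolding hausdorff_eq_SUP_seq by (intro SUP_mono')
  have "open_content m (2 * \<delta>) A \<le> hausdorff_pre m \<delta> A" if "0 < \<delta>" for \<delta>
    unfolding hausdorff_pre_def
  proof (rule INF_greatest, clarify)
    fix E :: "nat \<Rightarrow> 'a set"
    assume E: "A \<subseteq> (\<Union>i. E i)" "\<forall>i. bounded (E i) \<and> diameter (E i) \<le> \<delta>"
    show "open_content m (2 * \<delta>) A \<le> suminf (\<lambda>i. hausdorff_weight m (E i))"
    proof (rule ennreal_le_epsilon)
      fix e :: real assume e: "0 < e"
      have "\<exists>U. open U \<and> E i \<subseteq> U \<and> bounded U \<and> diameter U \<le> 2 * \<delta> \<and>
          hausdorff_weight m U \<le> hausdorff_weight m (E i) + ennreal (e * (1/2)^Suc i)" for i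
      proof -
        have "0 < e * (1/2)^Suc i" using e by simp
        then show ?thesis
          by (intro open_enlargement that) (use E(2) in auto)
      qed
      then obtain U where U: "\<And>i. open (U i)" "\<And>i. E i \<subseteq> U i" "\<And>i. bounded (U i)"
        "\<And>i. diameter (U i) \<le> 2 * \<delta>"
        "\<And>i. hausdorff_weight m (U i) \<le> hausdorff_weight m (E i) + ennreal (e * (1/2)^Suc i)"
        by metis
      have "A \<subseteq> (\<Union>i. U i)" using E(1) U(2) by blast
      then have "open_content m (2 * \<delta>) A \<le> suminf (\<lambda>i. hausdorff_weight m (U i))"
        unfolding open_content_def using U by (intro INF_lower) auto
      also have "\<dots> \<le> suminf (\<lambda>i. hausdorff_weight m (E i) + ennreal (e * (1/2)^Suc i))"
        by (intro suminf_le U summableI)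
      also have "\<dots> = suminf (\<lambda>i. hausdorff_weight m (E i)) + suminf (\<lambda>i. ennreal (e * (1/2)^Suc i))"
        by (intro suminf_add[symmetric] summableI)
      also have "suminf (\<lambda>i. ennreal (e * (1/2)^Suc i)) = ennreal e"
        using sums_mult[OF power_half_series, of e] e by (intro suminf_ennreal_eq) auto
      finally show "open_content m (2 * \<delta>) A \<le> suminf (\<lambda>i. hausdorff_weight m (E i)) + ennreal e" .
    qed
  qed
  then have half: "open_content m \<delta> A \<le> hausdorff_pre m (\<delta> / 2) A" if "0 < \<delta>" for \<delta>
    using that by (metis half_gt_zero nonzero_mult_div_cancel_left times_divide_eq_right zero_neq_numeral)
  have "open_content m (1 / real (Suc n)) A \<le> hausdorff m A" for n
    by (rule order_trans[OF half hausdorff_pre_le_hausdorff]) simp_all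
  then show "(SUP n. open_content m (1 / real (Suc n)) A) \<le> hausdorff m A"
    by (rule SUP_least)
qed

text \<open>
  The compact image keeps a positive distance \<open>r\<close> from the complement of \<open>U\<close>, while changing the map
  by less than \<open>r/B\<close> moves each point of \<open>K\<close> by less than \<open>r\<close>, where \<open>B\<close> bounds the norms in \<open>K\<close>.
\<close>
lemma open_blinfun_image_subset:
  fixes K :: "'a::real_normed_vector set" and U :: "'b::real_normed_vector set"
  assumes K: "compact K" and U: "open U"
  shows "open {\<pi> :: 'a \<Rightarrow>\<^sub>L 'b. blinfun_apply \<pi> ` K \<subseteq> U}"
proof (cases "K = {} \<or> U = UNIV")
  case False
  show ?thesis
    unfolding open_dist
  proof clarify
    fix \<pi> :: "'a \<Rightarrow>\<^sub>L 'b" assume sub: "blinfun_apply \<pi> ` K \<subseteq> U"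
    have cpt: "compact (blinfun_apply \<pi> ` K)"
      by (intro compact_continuous_image K linear_continuous_on blinfun.bounded_linear_right)
    have ne: "- U \<noteq> {}" "blinfun_apply \<pi> ` K \<noteq> {}" using False by auto
    have "\<exists>y\<in>blinfun_apply \<pi> ` K. \<forall>z\<in>blinfun_apply \<pi> ` K. infdist y (- U) \<le> infdist z (- U)"
      by (intro continuous_attains_inf cpt ne continuous_on_infdist continuous_on_id)
    then obtain y where y: "y \<in> blinfun_apply \<pi> ` K"
        "\<forall>z\<in>blinfun_apply \<pi> ` K. infdist y (- U) \<le> infdist z (- U)"
      by (rule bexE)
    define r where "r = infdist y (- U)"
    have r: "0 < r"
      using y(1) sub U ne in_closed_iff_infdist_zero[of "- U" y] infdist_nonneg[of y "- U"]
      by (auto simp: r_def closed_Compl)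
    obtain B where B: "0 < B" "\<And>x. x \<in> K \<Longrightarrow> norm x \<le> B"
      using compact_imp_bounded[OF K] bounded_pos by metis
    have "blinfun_apply \<pi>' ` K \<subseteq> U" if d: "dist \<pi>' \<pi> < r / B" for \<pi>'
    proof clarify
      fix x assume x: "x \<in> K"
      show "blinfun_apply \<pi>' x \<in> U"
      proof (rule ccontr)
        assume "blinfun_apply \<pi>' x \<notin> U"
        then have "infdist (blinfun_apply \<pi> x) (- U) \<le> dist (blinfun_apply \<pi> x) (blinfun_apply \<pi>' x)"
          by (intro infdist_le) auto
        also have "\<dots> = norm (blinfun_apply (\<pi> - \<pi>') x)"
          by (simp add: dist_norm blinfun.diff_left)
        also have "\<dots> \<le> norm (\<pi> - \<pi>') * norm x"
          by (rule norm_blinfun)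
        also have "\<dots> \<le> norm (\<pi> - \<pi>') * B"
          using B x by (intro mult_left_mono) auto
        also have "\<dots> < r"
          using d B(1) by (simp add: pos_less_divide_eq dist_norm norm_minus_commute)
        finally show False using y(2)[rule_format, of "blinfun_apply \<pi> x"] x unfolding r_def by force
      qed
    qed
    then show "\<exists>e>0. \<forall>\<pi>'. dist \<pi>' \<pi> < e \<longrightarrow> \<pi>' \<in> {\<pi>. blinfun_apply \<pi> ` K \<subseteq> U}"
      using divide_pos_pos[OF r B(1)] by blast
  qed
qed auto

text \<open>
  A cover by open sets still covers the images under nearby maps, so each content is an upper
  semicontinuous function of the map, and Hausdorff measure is a countable supremum of them.
\<close>
lemma measurable_hausdorff_blinfun_image:
  fixes K :: "'a::real_normed_vector set"
  assumes K: "compact K"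
  shows "(\<lambda>\<pi> :: 'a \<Rightarrow>\<^sub>L 'b::real_normed_vector. hausdorff m (blinfun_apply \<pi> ` K)) \<in> borel_measurable borel"
  unfolding hausdorff_eq_SUP_open_content
proof (rule borel_measurable_SUP)
  fix n :: nat
  let ?d = "1 / real (Suc n)"
  show "(\<lambda>\<pi> :: 'a \<Rightarrow>\<^sub>L 'b. open_content m ?d (blinfun_apply \<pi> ` K)) \<in> borel_measurable borel"
  proof (rule borel_measurableI_less)
    fix t :: ennreal
    define \<E> where "\<E> = {E :: nat \<Rightarrow> 'b set. (\<forall>i. open (E i) \<and> bounded (E i) \<and> diameter (E i) \<le> ?d)
        \<and> suminf (\<lambda>i. hausdorff_weight m (E i)) < t}"
    have "{\<pi> :: 'a \<Rightarrow>\<^sub>L 'b. open_content m ?d (blinfun_apply \<pi> ` K) < t} =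
        (\<Union>E\<in>\<E>. {\<pi>. blinfun_apply \<pi> ` K \<subseteq> (\<Union>i. E i)})"
      unfolding open_content_def INF_less_iff \<E>_def by auto
    moreover have "open (\<Union>E\<in>\<E>. {\<pi> :: 'a \<Rightarrow>\<^sub>L 'b. blinfun_apply \<pi> ` K \<subseteq> (\<Union>i. E i)})"
      by (intro open_UN ballI open_blinfun_image_subset K) (auto simp: \<E>_def)
    ultimately have "open {\<pi> :: 'a \<Rightarrow>\<^sub>L 'b. open_content m ?d (blinfun_apply \<pi> ` K) < t}"
      by simp
    then show "{\<pi> :: 'a \<Rightarrow>\<^sub>L 'b. \<pi> \<in> space borel \<and> open_content m ?d (blinfun_apply \<pi> ` K) < t} \<in> sets borel"
      by (simp add: borel_open)
  qed
qed simp

section \<open>Convex combinations of indexed families\<close>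

text \<open>
  The indexing need not be injective: distinct vertices may have the same image under a map.
\<close>
lemma convex_hull_indexed_finite:
  fixes p :: "'i \<Rightarrow> 'a::real_vector"
  assumes I: "finite I"
  shows "convex hull (p ` I) =
    {x. \<exists>u. (\<forall>i\<in>I. 0 \<le> u i) \<and> sum u I = 1 \<and> (\<Sum>i\<in>I. u i *\<^sub>R p i) = x}" (is "_ = ?R")
proof (rule equalityI)
  show "convex hull (p ` I) \<subseteq> ?R"
  proof (rule hull_minimal)
    show "p ` I \<subseteq> ?R"
    proof clarify
      fix i assume i: "i \<in> I"
      have "(\<Sum>j\<in>I. (if j = i then 1 else 0) *\<^sub>R p j) = (\<Sum>j\<in>I. if j = i then p j else 0)"
        by (intro sum.cong) auto
      then show "\<exists>u. (\<forall>j\<in>I. 0 \<le> u j) \<and> sum u I = 1 \<and> (\<Sum>j\<in>I. u j *\<^sub>R p j) = p i"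
        using I i by (intro exI[of _ "\<lambda>j. if j = i then 1 else 0"]) simp
    qed
    show "convex ?R"
    proof (rule convexI, clarify)
      fix u v :: "'i \<Rightarrow> real" and a b :: real
      assume ab: "0 \<le> a" "0 \<le> b" "a + b = 1"
        and u: "\<forall>i\<in>I. 0 \<le> u i" "sum u I = 1" and v: "\<forall>i\<in>I. 0 \<le> v i" "sum v I = 1"
      show "\<exists>w. (\<forall>i\<in>I. 0 \<le> w i) \<and> sum w I = 1 \<and>
          (\<Sum>i\<in>I. w i *\<^sub>R p i) = a *\<^sub>R (\<Sum>i\<in>I. u i *\<^sub>R p i) + b *\<^sub>R (\<Sum>i\<in>I. v i *\<^sub>R p i)"
      proof (intro exI conjI ballI)
        show "0 \<le> a * u i + b * v i" if "i \<in> I" for i using ab u v that by simp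
        show "(\<Sum>i\<in>I. a * u i + b * v i) = 1"
          using ab u v by (simp add: sum.distrib flip: sum_distrib_left)
      qed (simp add: scaleR_left_distrib sum.distrib scaleR_sum_right)
    qed
  qed
  show "?R \<subseteq> convex hull (p ` I)"
  proof clarify
    fix u :: "'i \<Rightarrow> real" assume u: "\<forall>i\<in>I. 0 \<le> u i" "sum u I = 1"
    show "(\<Sum>i\<in>I. u i *\<^sub>R p i) \<in> convex hull (p ` I)"
      by (rule convex_sum) (use I u in \<open>auto intro: hull_inc\<close>)
  qed
qed

lemma convex_hull_list:
  fixes \<sigma> :: "'a::real_vector list"
  shows "convex hull (set \<sigma>) = {x. \<exists>u. (\<forall>i<length \<sigma>. 0 \<le> u i) \<and> (\<Sum>i<length \<sigma>. u i) = 1 \<and>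
    (\<Sum>i<length \<sigma>. u i *\<^sub>R \<sigma> ! i) = x}"
proof -
  have "set \<sigma> = (!) \<sigma> ` {..<length \<sigma>}" by (auto simp: set_conv_nth)
  then show ?thesis by (simp add: convex_hull_indexed_finite Ball_def)
qed

text \<open>
  Moving the coordinates \<open>\<rho>\<close> in the direction \<open>d\<close>, the first coordinate to reach \<open>0\<close> is one that
  minimises \<open>\<rho> k / - d k\<close>.
\<close>
lemma push_to_facet:
  fixes \<rho> d :: "'i \<Rightarrow> real"
  assumes I: "finite I" and \<rho>: "\<forall>i\<in>I. 0 \<le> \<rho> i" and neg: "\<exists>k\<in>I. d k < 0"
  obtains t k where "0 \<le> t" "k \<in> I" "d k < 0" "\<rho> k + t * d k = 0" "\<forall>i\<in>I. 0 \<le> \<rho> i + t * d i"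
proof -
  define K where "K = {k \<in> I. d k < 0}"
  have K: "finite K" "K \<noteq> {}" using I neg by (auto simp: K_def)
  define t where "t = Min ((\<lambda>k. \<rho> k / - d k) ` K)"
  have "t \<in> (\<lambda>k. \<rho> k / - d k) ` K" unfolding t_def using K by (intro Min_in) auto
  then obtain k where k: "k \<in> K" "t = \<rho> k / - d k" by auto
  have t: "0 \<le> t" using k \<rho> by (auto simp: K_def divide_nonneg_neg)
  show ?thesis
  proof (rule that)
    show "0 \<le> t" by (rule t)
    show "k \<in> I" "d k < 0" using k by (auto simp: K_def)
    then show "\<rho> k + t * d k = 0" using k by simp
    show "\<forall>i\<in>I. 0 \<le> \<rho> i + t * d i"
    proof
      fix i assume i: "i \<in> I"
      show "0 \<le> \<rho> i + t * d i"
      proof (cases "d i < 0")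
        case True
        then have "t \<le> \<rho> i / - d i" unfolding t_def using K i by (intro Min_le) (auto simp: K_def)
        then have "t * - d i \<le> \<rho> i" using True by (subst (asm) pos_le_divide_eq) auto
        then show ?thesis by simp
      qed (use t \<rho> i in simp)
    qed
  qed
qed

section \<open>A line crosses the boundary of a simplex in two facets\<close>

definition signed :: "real \<Rightarrow> 'g::ab_group_add \<Rightarrow> 'g" where
  "signed r g = (if 0 < r then g else if r < 0 then - g else 0)"

lemma signed_0 [simp]: "signed 0 g = 0" "signed r 0 = 0"
  by (auto simp: signed_def)

lemma signed_add: "signed r (g + h) = signed r g + signed r h"
  by (simp add: signed_def)

lemma signed_minus: "signed r (- g) = - signed r g" "signed (- r) g = - signed r g"
  by (auto simp: signed_def)

lemma signed_mult_pos: "0 < a \<Longrightarrow> signed (a * r) g = signed r g"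
  by (auto simp: signed_def zero_less_mult_iff mult_less_0_iff)

lemma signed_mult_neg: "a < 0 \<Longrightarrow> signed (a * r) g = - signed r g"
  by (auto simp: signed_def zero_less_mult_iff mult_less_0_iff)

text \<open>
  If \<open>d\<close> is not \<open>0\<close>, it is the only affine dependency of the points \<open>p i\<close> up to scaling, so the convex
  representations of \<open>x\<close> form a segment in the direction \<open>d\<close> in the standard simplex.  A facet \<open>j\<close> with \<open>d j > 0\<close>
  is where the coordinate \<open>j\<close> becomes positive along \<open>d\<close>, and one with \<open>d j < 0\<close> is where it becomes
  negative.  As \<open>x\<close> avoids the faces of codimension two, the segment, if there is one, has its end
  points inside one facet of each kind.
\<close>
lemma line_crosses_facets_in_pairs:
  fixes d :: "'i \<Rightarrow> real" and p :: "'i \<Rightarrow> 'a::real_vector"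
  assumes I: "finite I"
    and d: "sum d I = 0" "(\<Sum>i\<in>I. d i *\<^sub>R p i) = 0"
    and unique: "\<And>j \<mu>. j \<in> I \<Longrightarrow> d j \<noteq> 0 \<Longrightarrow> sum \<mu> I = 0 \<Longrightarrow> (\<Sum>i\<in>I. \<mu> i *\<^sub>R p i) = 0 \<Longrightarrow>
      \<mu> j = 0 \<Longrightarrow> \<forall>i\<in>I. \<mu> i = 0"
    and generic: "\<And>i j. i \<in> I \<Longrightarrow> j \<in> I \<Longrightarrow> i \<noteq> j \<Longrightarrow> x \<notin> convex hull (p ` (I - {i, j}))"
  shows "(\<Sum>j\<in>I. if x \<in> convex hull (p ` (I - {j})) then signed (d j) g else 0) = 0"
proof -
  define rep where "rep \<rho> \<longleftrightarrow> (\<forall>i\<in>I. 0 \<le> \<rho> i) \<and> sum \<rho> I = 1 \<and> (\<Sum>i\<in>I. \<rho> i *\<^sub>R p i) = x" for \<rho> :: "'i \<Rightarrow> real"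
  have hull_iff: "x \<in> convex hull (p ` (I - Z)) \<longleftrightarrow> (\<exists>\<rho>. rep \<rho> \<and> (\<forall>z\<in>Z. \<rho> z = 0))" if Z: "Z \<subseteq> I" for Z
  proof
    assume "x \<in> convex hull (p ` (I - Z))"
    then obtain u where u: "\<forall>i\<in>I - Z. 0 \<le> u i" "sum u (I - Z) = 1" "(\<Sum>i\<in>I - Z. u i *\<^sub>R p i) = x"
      using I by (auto simp: convex_hull_indexed_finite)
    let ?u = "\<lambda>i. if i \<in> Z then 0 else u i"
    have "sum ?u I = sum u (I - Z)" "(\<Sum>i\<in>I. ?u i *\<^sub>R p i) = (\<Sum>i\<in>I - Z. u i *\<^sub>R p i)"
      using I by (auto intro!: sum.mono_neutral_cong_right)
    then have "rep ?u" using u unfolding rep_def by auto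
    then show "\<exists>\<rho>. rep \<rho> \<and> (\<forall>z\<in>Z. \<rho> z = 0)" by (intro exI[of _ ?u]) auto
  next
    assume "\<exists>\<rho>. rep \<rho> \<and> (\<forall>z\<in>Z. \<rho> z = 0)"
    then obtain \<rho> where l: "rep \<rho>" "\<forall>z\<in>Z. \<rho> z = 0" by blast
    have "sum \<rho> (I - Z) = sum \<rho> I" "(\<Sum>i\<in>I - Z. \<rho> i *\<^sub>R p i) = (\<Sum>i\<in>I. \<rho> i *\<^sub>R p i)"
      using I Z l by (auto intro!: sum.mono_neutral_left)
    then show "x \<in> convex hull (p ` (I - Z))"
      using I l(1) by (auto simp: convex_hull_indexed_finite rep_def)
  qed
  have pos: "0 < \<rho> i" if "rep \<rho>" "j \<in> I" "\<rho> j = 0" "i \<in> I" "i \<noteq> j" for \<rho> i j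
  proof -
    have "\<rho> i \<noteq> 0"
      using generic[of i j] hull_iff[of "{i, j}"] that by auto
    then show ?thesis using that by (auto simp: rep_def order_le_less)
  qed
  define J where "J = {j \<in> I. d j \<noteq> 0 \<and> x \<in> convex hull (p ` (I - {j}))}"
  have J: "\<exists>\<rho>. rep \<rho> \<and> \<rho> j = 0" if "j \<in> J" for j
    using that hull_iff[of "{j}"] by (auto simp: J_def)
  have opp: "d j * d k < 0" if jk: "j \<in> J" "k \<in> J" "j \<noteq> k" for j k
  proof -
    obtain \<rho> \<rho>' where l: "rep \<rho>" "\<rho> j = 0" "rep \<rho>'" "\<rho>' k = 0" using J jk by blast
    have I': "j \<in> I" "k \<in> I" "d j \<noteq> 0" using jk by (auto simp: J_def)
    \<comment> \<open>The difference of the two representations is a multiple of \<open>d\<close>; its signs at \<open>j\<close> and \<open>k\<close> are known.\<close>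
    define t where "t = \<rho>' j / d j"
    have "\<forall>i\<in>I. \<rho>' i - \<rho> i - t * d i = 0"
    proof (rule unique[OF I'(1,3)])
      show "(\<Sum>i\<in>I. \<rho>' i - \<rho> i - t * d i) = 0"
        using l d by (simp add: rep_def sum_subtractf flip: sum_distrib_left)
      have "(\<Sum>i\<in>I. (\<rho>' i - \<rho> i - t * d i) *\<^sub>R p i) =
          (\<Sum>i\<in>I. \<rho>' i *\<^sub>R p i) - (\<Sum>i\<in>I. \<rho> i *\<^sub>R p i) - t *\<^sub>R (\<Sum>i\<in>I. d i *\<^sub>R p i)"
        by (simp add: scaleR_left_diff_distrib sum_subtractf scaleR_sum_right)
      then show "(\<Sum>i\<in>I. (\<rho>' i - \<rho> i - t * d i) *\<^sub>R p i) = 0"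
        using l d by (simp add: rep_def)
      show "\<rho>' j - \<rho> j - t * d j = 0" using l I' by (simp add: t_def)
    qed
    then have "\<rho> k = - (t * d k)" using I' l by force
    moreover have "0 < \<rho> k" "0 < \<rho>' j" using pos l I' jk by metis+
    moreover have "\<rho>' j = t * d j" using I' by (simp add: t_def)
    ultimately have "t * d k < 0" "0 < t * d j" by auto
    then show ?thesis by (auto simp: mult_less_0_iff zero_less_mult_iff)
  qed
  have ex_opp: "\<exists>k\<in>J. d j * d k < 0" if j: "j \<in> J" for j
  proof -
    obtain \<rho> where l: "rep \<rho>" "\<rho> j = 0" using J j by blast
    \<comment> \<open>The multiple of \<open>d\<close> that increases the coordinate \<open>j\<close>: it points from the facet \<open>j\<close> inwards.\<close>
    let ?e = "\<lambda>i. d j * d i"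
    have e: "sum ?e I = 0" "(\<Sum>i\<in>I. ?e i *\<^sub>R p i) = 0"
      using d by (simp_all flip: sum_distrib_left scaleR_scaleR scaleR_sum_right)
    have "0 < ?e j" using j by (auto simp: J_def zero_less_mult_iff)
    then have "\<exists>k\<in>I. ?e k < 0"
      using e(1) I j sum_pos2[of I j ?e] by (force simp: J_def not_less)
    then obtain t k where t: "0 \<le> t" "k \<in> I" "?e k < 0" "\<rho> k + t * ?e k = 0" "\<forall>i\<in>I. 0 \<le> \<rho> i + t * ?e i"
      using push_to_facet[of I \<rho> ?e] I l by (auto simp: rep_def)
    have "(\<Sum>i\<in>I. (\<rho> i + t * ?e i) *\<^sub>R p i) = (\<Sum>i\<in>I. \<rho> i *\<^sub>R p i) + t *\<^sub>R (\<Sum>i\<in>I. ?e i *\<^sub>R p i)"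
      by (simp add: scaleR_left_distrib sum.distrib scaleR_sum_right)
    moreover have "(\<Sum>i\<in>I. \<rho> i + t * ?e i) = sum \<rho> I + t * sum ?e I"
      by (simp add: sum.distrib sum_distrib_left)
    ultimately have "rep (\<lambda>i. \<rho> i + t * ?e i)"
      using l t e unfolding rep_def by simp
    then have "x \<in> convex hull (p ` (I - {k}))"
      using hull_iff[of "{k}"] t by auto
    then show ?thesis using t by (auto simp: J_def)
  qed
  have "(\<Sum>j\<in>I. if x \<in> convex hull (p ` (I - {j})) then signed (d j) g else 0) = (\<Sum>j\<in>J. signed (d j) g)"
    using I by (intro sum.mono_neutral_cong_right) (auto simp: J_def)
  also have "\<dots> = 0"
  proof (cases "J = {}")
    case False
    have nz: "d j \<noteq> 0" if "j \<in> J" for j using that by (simp add: J_def)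
    then obtain j k where jk: "j \<in> J" "0 < d j" "k \<in> J" "d k < 0"
      using False ex_opp by (metis all_not_in_conv linorder_neqE_linordered_idom mult_less_0_iff)
    have "J \<subseteq> {j, k}"
    proof
      fix i assume i: "i \<in> J"
      show "i \<in> {j, k}"
      proof (rule ccontr)
        assume "i \<notin> {j, k}"
        then have "d i * d j < 0" "d i * d k < 0" using opp i jk by auto
        then show False using jk by (auto simp: mult_less_0_iff)
      qed
    qed
    then have "J = {j, k}" using jk by blast
    moreover have "j \<noteq> k" using jk by auto
    ultimately show ?thesis using jk by (simp add: signed_def)
  qed simp
  finally show ?thesis .
qed

section \<open>Crossing numbers of simplexes\<close>

lemma nth_take_drop_Suc:
  assumes "j < length \<sigma>" "i < length \<sigma> - 1"
  shows "(take j \<sigma> @ drop (Suc j) \<sigma>) ! i = \<sigma> ! (if i < j then i else Suc i)"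
  using assms by (auto simp: nth_append)

lemma set_take_drop_Suc:
  assumes "j < length \<sigma>"
  shows "set (take j \<sigma> @ drop (Suc j) \<sigma>) = (!) \<sigma> ` ({..<length \<sigma>} - {j})"
proof -
  have "set (take j \<sigma>) = (!) \<sigma> ` {0..<j}"
    using nth_image[of j \<sigma>] assms by simp
  moreover have "set (drop (Suc j) \<sigma>) = (!) \<sigma> ` {Suc j..<length \<sigma>}"
  proof -
    have "set (drop (Suc j) \<sigma>) = (!) (drop (Suc j) \<sigma>) ` {0..<length \<sigma> - Suc j}"
      by (auto simp: set_conv_nth)
    also have "\<dots> = (!) \<sigma> ` (\<lambda>i. i + Suc j) ` {0..<length \<sigma> - Suc j}"
      by (simp add: image_image add.commute)
    also have "(\<lambda>i. i + Suc j) ` {0..<length \<sigma> - Suc j} = {Suc j..<length \<sigma>}"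
      using assms by (subst image_add_atLeastLessThan')
        (simp only: add_0 le_add_diff_inverse2 Suc_leI)
    finally show ?thesis .
  qed
  moreover have "{..<length \<sigma>} - {j} = {0..<j} \<union> {Suc j..<length \<sigma>}"
    using assms by auto
  ultimately show ?thesis by (simp add: image_Un)
qed

lemma bij_betw_skip:
  "j \<le> n \<Longrightarrow> bij_betw (\<lambda>i. if i < j then i else Suc i) {..<n} ({..n} - {j})"
  by (rule bij_betw_byWitness[where f' = "\<lambda>i. if i < j then i else i - 1"]) auto

text \<open>
  The first \<open>m\<close> of the functionals \<open>c\<close> have the kernel of \<open>\<pi>\<close> as their common kernel.  They embed the
  range of \<open>\<pi>\<close> into \<open>\<real>\<^sup>m\<close>, which lets determinants measure orientations there, and say that \<open>\<pi>\<close> has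
  rank at most \<open>m\<close>.  As functions of \<open>v\<close> rather than of \<open>\<pi> v\<close> they are linear on the whole space.
\<close>
locale coordinatized_map =
  fixes m :: nat and \<pi> :: "'a::real_normed_vector \<Rightarrow> 'a" and c :: "'a \<Rightarrow> nat \<Rightarrow> real"
  assumes m: "1 \<le> m"
    and linear_map: "linear \<pi>"
    and linear_coord: "\<And>i. linear (\<lambda>v. c v i)"
    and coord_eq_0: "\<And>v. (\<forall>i<m. c v i = 0) \<longleftrightarrow> \<pi> v = 0"
begin

definition vdet :: "'a list \<Rightarrow> real" where
  "vdet \<tau> = Determinant.det (Matrix.mat m m (\<lambda>(i, j). c (\<tau> ! j) i))"

text \<open>
  The cone over the image of a simplex with apex \<open>0\<close>.  A point \<open>x \<noteq> 0\<close> lies in it if and only if the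
  ray that leaves \<open>x\<close> in the direction away from \<open>0\<close> meets the image.
\<close>
definition image_cone :: "'a set \<Rightarrow> 'a set" where
  "image_cone S = convex hull (insert 0 (\<pi> ` S))"

definition crossing :: "'a \<Rightarrow> 'a list \<Rightarrow> 'g::ab_group_add \<Rightarrow> 'g" where
  "crossing x \<tau> g = (if x \<in> image_cone (set \<tau>) then signed (vdet \<tau>) g else 0)"

lemma coord_sum: "c (\<Sum>j\<in>J. u j *\<^sub>R v j) i = (\<Sum>j\<in>J. u j * c (v j) i)"
  using linear_sum[OF linear_coord[of i], of "\<lambda>j. u j *\<^sub>R v j" J]
  by (simp add: linear_cmul[OF linear_coord[of i]])

lemma map_sum: "\<pi> (\<Sum>j\<in>J. u j *\<^sub>R v j) = (\<Sum>j\<in>J. u j *\<^sub>R \<pi> (v j))"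
  by (simp add: linear_sum[OF linear_map] linear_cmul[OF linear_map])

text \<open>
  A linear relation between the images of the vertices is a kernel vector of the matrix.
\<close>
lemma vdet_nonzero_independent:
  assumes det: "vdet \<tau> \<noteq> 0" and zero: "(\<Sum>j<m. u j *\<^sub>R \<pi> (\<tau> ! j)) = 0" and j: "j < m"
  shows "u j = 0"
proof -
  let ?A = "Matrix.mat m m (\<lambda>(i, j). c (\<tau> ! j) i)"
  have "\<pi> (\<Sum>j<m. u j *\<^sub>R \<tau> ! j) = 0"
    using zero by (simp add: map_sum)
  then have "c (\<Sum>j<m. u j *\<^sub>R \<tau> ! j) i = 0" if "i < m" for i
    using that coord_eq_0 by blast
  then have "(\<Sum>j<m. u j * c (\<tau> ! j) i) = 0" if "i < m" for i
    using that by (simp add: coord_sum)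
  then have "?A *\<^sub>v Matrix.vec m u = 0\<^sub>v m"
    by (intro eq_vecI) (auto simp: scalar_prod_def atLeast0LessThan mult.commute)
  then have "Matrix.vec m u = 0\<^sub>v m"
    using det det_0_iff_vec_prod_zero_field[of ?A m] vec_carrier[of m u]
    unfolding vdet_def using mat_carrier by blast
  then show ?thesis
    using j by (metis index_vec index_zero_vec(1))
qed

text \<open>
  Replacing \<open>\<tau>\<^sub>j\<close> by \<open>\<tau>\<^sub>j - \<tau>\<^sub>0\<close> for \<open>j > 0\<close> does not change the determinant.  The frames
  obtained in this way from \<open>\<sigma>\<close> and \<open>\<tau>\<close> are related by the block triangular matrix that has \<open>1\<close>, the
  coordinates of \<open>\<tau>\<^sub>0 - \<sigma>\<^sub>0\<close>, and \<open>A\<close> as its blocks.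
\<close>
lemma vdet_transition:
  assumes A: "edge_transition (m - 1) \<sigma> \<tau> A"
    and a: "sum a {..<m} = 1" "\<tau> ! 0 = (\<Sum>i<m. a i *\<^sub>R \<sigma> ! i)"
  shows "vdet \<tau> = Determinant.det A * vdet \<sigma>"
proof -
  obtain k where k: "m = Suc k" using m by (cases m) auto
  let ?pts = "\<lambda>\<rho>. Matrix.mat m m (\<lambda>(i, j). c (\<rho> ! j) i)"
  define frame where "frame \<rho> = Matrix.mat m m (\<lambda>(i, j). c (if j = 0 then \<rho> ! 0 else \<rho> ! j - \<rho> ! 0) i)"
    for \<rho> :: "'a list"
  define E where "E = Matrix.mat m m (\<lambda>(i, j). if i = j then 1 else if i = 0 then - 1 else 0 :: real)"
  have det_E: "Determinant.det E = 1"
  proof -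
    have "Determinant.det E = prod_list (diag_mat E)"
      by (rule det_upper_triangular[where n = m]) (auto simp: E_def)
    also have "diag_mat E = replicate m 1"
      by (auto simp: diag_mat_def E_def intro!: nth_equalityI)
    finally show ?thesis by simp
  qed
  have frame: "Determinant.det (frame \<rho>) = vdet \<rho>" for \<rho>
  proof -
    have "frame \<rho> = ?pts \<rho> * E"
    proof (rule eq_matI)
      fix i j assume "i < dim_row (?pts \<rho> * E)" "j < dim_col (?pts \<rho> * E)"
      then have ij: "i < m" "j < m" by (simp_all add: E_def)
      have "(?pts \<rho> * E) $$ (i, j) = (\<Sum>l<m. c (\<rho> ! l) i * E $$ (l, j))"
        using ij by (simp add: scalar_prod_def atLeast0LessThan E_def)
      also have "\<dots> = (\<Sum>l<m. if l = j then c (\<rho> ! l) i else if l = 0 then - c (\<rho> ! 0) i else 0)"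
        using ij by (intro sum.cong) (auto simp: E_def)
      also have "\<dots> = (if j = 0 then c (\<rho> ! 0) i else c (\<rho> ! j) i - c (\<rho> ! 0) i)"
      proof (cases "j = 0")
        case False
        have "(\<Sum>l<m. if l = j then c (\<rho> ! l) i else if l = 0 then - c (\<rho> ! 0) i else 0) =
            (\<Sum>l<m. (if l = j then c (\<rho> ! j) i else 0) + (if l = 0 then - c (\<rho> ! 0) i else 0))"
          using False by (intro sum.cong) auto
        then show ?thesis using False ij m by (simp add: sum.distrib)
      qed (use m in \<open>simp add: if_distrib cong: if_cong\<close>)
      also have "\<dots> = frame \<rho> $$ (i, j)"
        using ij by (simp add: frame_def linear_diff[OF linear_coord])
      finally show "frame \<rho> $$ (i, j) = (?pts \<rho> * E) $$ (i, j)" ..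
    qed (auto simp: frame_def E_def)
    then have "Determinant.det (frame \<rho>) = vdet \<rho> * Determinant.det E"
      unfolding vdet_def by (simp add: det_mult[where n = m] E_def)
    then show ?thesis by (simp add: det_E)
  qed
  define B where "B = Matrix.mat m m (\<lambda>(i, j). if j = 0 then (if i = 0 then 1 else a i)
    else if i = 0 then 0 else A $$ (i - 1, j - 1))"
  have Ac: "A \<in> carrier_mat k k" using A k by (simp add: edge_transition_def)
  have det_B: "Determinant.det B = Determinant.det A"
  proof -
    have "Determinant.det B = (\<Sum>j<m. B $$ (0, j) * cofactor B 0 j)"
      by (rule laplace_expansion_row) (auto simp: B_def k)
    also have "\<dots> = (\<Sum>j<m. if j = 0 then cofactor B 0 0 else 0)"
      by (intro sum.cong) (auto simp: B_def k)
    also have "\<dots> = Determinant.det (mat_delete B 0 0)"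
      by (simp add: k cofactor_def)
    also have "mat_delete B 0 0 = A"
      using Ac by (intro eq_matI) (auto simp: mat_delete_def B_def k)
    finally show ?thesis .
  qed
  have "frame \<tau> = frame \<sigma> * B"
  proof (rule eq_matI)
    fix i j assume "i < dim_row (frame \<sigma> * B)" "j < dim_col (frame \<sigma> * B)"
    then have ij: "i < m" "j < m" by (simp_all add: B_def frame_def)
    define e where "e l = c (\<sigma> ! Suc l - \<sigma> ! 0) i" for l
    have "(frame \<sigma> * B) $$ (i, j) = (\<Sum>l<m. frame \<sigma> $$ (i, l) * B $$ (l, j))"
      using ij by (simp add: scalar_prod_def atLeast0LessThan B_def frame_def)
    also have "\<dots> = c (\<sigma> ! 0) i * B $$ (0, j) + (\<Sum>l<k. e l * B $$ (Suc l, j))"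
      using ij unfolding k sum.lessThan_Suc_shift by (simp add: frame_def e_def k)
    also have "\<dots> = frame \<tau> $$ (i, j)"
    proof (cases j)
      case 0
      have "a 0 = 1 - (\<Sum>l<k. a (Suc l))"
        using a(1) unfolding k sum.lessThan_Suc_shift by simp
      then have "\<tau> ! 0 = \<sigma> ! 0 + (\<Sum>l<k. a (Suc l) *\<^sub>R (\<sigma> ! Suc l - \<sigma> ! 0))"
        using a(2) unfolding k sum.lessThan_Suc_shift
        by (simp add: scaleR_left_diff_distrib scaleR_right_diff_distrib sum_subtractf scaleR_sum_left)
      then have "c (\<tau> ! 0) i = c (\<sigma> ! 0) i + (\<Sum>l<k. a (Suc l) * e l)"
        by (simp add: linear_add[OF linear_coord] coord_sum e_def)
      then show ?thesis using ij 0 by (simp add: frame_def B_def k mult.commute)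
    next
      case (Suc j')
      then have "\<tau> ! j - \<tau> ! 0 = (\<Sum>l<k. A $$ (l, j') *\<^sub>R (\<sigma> ! Suc l - \<sigma> ! 0))"
        using A ij by (simp add: edge_transition_def k)
      then have "c (\<tau> ! j - \<tau> ! 0) i = (\<Sum>l<k. A $$ (l, j') * e l)"
        by (simp add: coord_sum e_def)
      then show ?thesis using ij Suc by (simp add: frame_def B_def k mult.commute)
    qed
    finally show "frame \<tau> $$ (i, j) = (frame \<sigma> * B) $$ (i, j)" ..
  qed (auto simp: frame_def B_def)
  then have "Determinant.det (frame \<tau>) = Determinant.det (frame \<sigma>) * Determinant.det B"
    by (simp add: det_mult[where n = m] frame_def B_def)
  then show ?thesis by (simp add: frame det_B mult.commute)
qed

lemma vdet_transition_hull:
  assumes \<sigma>: "length \<sigma> = m" and A: "edge_transition (m - 1) \<sigma> \<tau> A" and \<tau>: "\<tau> ! 0 \<in> convex hull (set \<sigma>)"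
  shows "vdet \<tau> = Determinant.det A * vdet \<sigma>"
proof -
  obtain a where "sum a {..<m} = 1" "(\<Sum>i<m. a i *\<^sub>R \<sigma> ! i) = \<tau> ! 0"
    using \<tau> \<sigma> by (auto simp: convex_hull_list)
  then show ?thesis using vdet_transition[OF A, of a] by simp
qed

lemma crossing_opposite:
  assumes "opposite_simplex (m - 1) \<sigma> \<tau>"
  shows "crossing x \<tau> (- g) = crossing x \<sigma> g"
proof -
  obtain A where A: "edge_transition (m - 1) \<sigma> \<tau> A" "Determinant.det A < 0"
    and len: "length \<sigma> = m" "length \<tau> = m" and set: "set \<sigma> = set \<tau>"
    using assms m by (auto simp: opposite_simplex_def oriented_simplex_def)
  have "\<tau> ! 0 \<in> set \<sigma>" using set len m by simp
  then have "vdet \<tau> = Determinant.det A * vdet \<sigma>"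
    by (intro vdet_transition_hull A len hull_inc)
  then show ?thesis
    using A(2) by (simp add: crossing_def set signed_minus signed_mult_neg)
qed

lemma mem_image_cone_iff:
  assumes "S \<noteq> {}"
  shows "x \<in> image_cone S \<longleftrightarrow> (\<exists>t y. 0 \<le> t \<and> t \<le> 1 \<and> y \<in> convex hull S \<and> x = t *\<^sub>R \<pi> y)"
proof -
  have "x \<in> image_cone S \<longleftrightarrow> (\<exists>u\<ge>0. \<exists>t\<ge>0. \<exists>b. u + t = 1 \<and> b \<in> \<pi> ` (convex hull S) \<and> x = t *\<^sub>R b)"
    using assms unfolding image_cone_def
    by (subst convex_hull_insert) (auto simp: convex_hull_linear_image[OF linear_map])
  also have "\<dots> \<longleftrightarrow> (\<exists>t y. 0 \<le> t \<and> t \<le> 1 \<and> y \<in> convex hull S \<and> x = t *\<^sub>R \<pi> y)"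
  proof (intro iffI)
    assume "\<exists>u\<ge>0. \<exists>t\<ge>0. \<exists>b. u + t = 1 \<and> b \<in> \<pi> ` (convex hull S) \<and> x = t *\<^sub>R b"
    then obtain u t y where "0 \<le> u" "0 \<le> t" "u + t = 1" "y \<in> convex hull S" "x = t *\<^sub>R \<pi> y"
      by blast
    then show "\<exists>t y. 0 \<le> t \<and> t \<le> 1 \<and> y \<in> convex hull S \<and> x = t *\<^sub>R \<pi> y"
      by (intro exI[of _ t] exI[of _ y]) simp
  next
    assume "\<exists>t y. 0 \<le> t \<and> t \<le> 1 \<and> y \<in> convex hull S \<and> x = t *\<^sub>R \<pi> y"
    then obtain t y where "0 \<le> t" "t \<le> 1" "y \<in> convex hull S" "x = t *\<^sub>R \<pi> y"
      by blast
    then show "\<exists>u\<ge>0. \<exists>t\<ge>0. \<exists>b. u + t = 1 \<and> b \<in> \<pi> ` (convex hull S) \<and> x = t *\<^sub>R b"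
      by (intro exI[of _ "1 - t"] exI[of _ t] exI[of _ "\<pi> y"] conjI) auto
  qed
  finally show ?thesis .
qed

text \<open>
  If the determinant does not vanish, \<open>\<pi>\<close> is injective on the linear span of \<open>\<sigma>\<close>, and \<open>0\<close> is not in
  the affine hull of the image, so each line through \<open>0\<close> meets the image at most once.
\<close>
lemma ray_hits_once:
  assumes len: "length \<sigma> = m" and det: "vdet \<sigma> \<noteq> 0"
    and y: "y \<in> convex hull (set \<sigma>)" "y' \<in> convex hull (set \<sigma>)"
    and eq: "t *\<^sub>R \<pi> y = t' *\<^sub>R \<pi> y'" and t: "t *\<^sub>R \<pi> y \<noteq> 0"
  shows "y = y'"
proof -
  obtain u u' where u: "sum u {..<m} = 1" "(\<Sum>i<m. u i *\<^sub>R \<sigma> ! i) = y"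
    and u': "sum u' {..<m} = 1" "(\<Sum>i<m. u' i *\<^sub>R \<sigma> ! i) = y'"
    using y len by (auto simp: convex_hull_list)
  have "(\<Sum>i<m. (t * u i - t' * u' i) *\<^sub>R \<pi> (\<sigma> ! i)) = t *\<^sub>R \<pi> y - t' *\<^sub>R \<pi> y'"
    unfolding u(2)[symmetric] u'(2)[symmetric] map_sum
    by (simp add: scaleR_left_diff_distrib sum_subtractf scaleR_sum_right)
  then have z: "t * u i = t' * u' i" if "i < m" for i
    using vdet_nonzero_independent[OF det, of "\<lambda>i. t * u i - t' * u' i" i] eq that by simp
  then have "(\<Sum>i<m. t * u i) = (\<Sum>i<m. t' * u' i)" by simp
  then have "t = t'" using u(1) u'(1) by (simp flip: sum_distrib_left)
  moreover have "t \<noteq> 0" using t by auto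
  ultimately have "u i = u' i" if "i < m" for i using z[OF that] by simp
  then show ?thesis using u(2) u'(2) by auto
qed

end

text \<open>
  Only a face that contains all the vertices is improper.  A vertex \<open>s\<close> outside the face cannot occur
  with positive weight in one of its points, as that point would lie on a segment issuing from \<open>s\<close>.
\<close>
lemma proper_face_subset_facet:
  fixes S :: "'a::real_vector set"
  assumes S: "finite S" and F: "F face_of (convex hull S)" and ne: "F \<noteq> convex hull S"
  obtains s where "s \<in> S" "F \<subseteq> convex hull (S - {s})"
proof -
  have "\<not> S \<subseteq> F"
  proof
    assume "S \<subseteq> F"
    then have "convex hull S \<subseteq> F" using face_of_imp_convex[OF F] by (simp add: hull_minimal)
    then show False using ne face_of_imp_subset[OF F] by blast
  qed
  then obtain s where s: "s \<in> S" "s \<notin> F" by blast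
  have "y \<in> convex hull (S - {s})" if y: "y \<in> F" for y
  proof (cases "S = {s}")
    case True
    then show ?thesis using y s face_of_imp_subset[OF F] by auto
  next
    case False
    have "y \<in> convex hull (insert s (S - {s}))"
      using y s face_of_imp_subset[OF F] by (auto simp: insert_absorb)
    then obtain u v b where uv: "0 \<le> u" "0 \<le> v" "u + v = 1" "b \<in> convex hull (S - {s})"
      "y = u *\<^sub>R s + v *\<^sub>R b"
      using False s by (subst (asm) convex_hull_insert) auto
    show ?thesis
    proof (cases "u = 0")
      case False
      have "v \<noteq> 0" using uv y s False by auto
      have "u = 1 - v" using uv by simp
      have sb: "s \<in> convex hull S" "b \<in> convex hull S"
        using s uv hull_mono[of "S - {s}" S convex] by (auto intro: hull_inc)
      have "b \<noteq> s"
      proof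
        assume "b = s"
        then have "y = s" using uv by (simp flip: scaleR_left_distrib)
        then show False using y s by simp
      qed
      then have "y \<in> open_segment s b"
        using uv False \<open>v \<noteq> 0\<close> \<open>u = 1 - v\<close> unfolding in_segment
        by (intro conjI exI[of _ v]) auto
      then have "s \<in> F" using F sb y unfolding face_of_def by blast
      then show ?thesis using s by simp
    qed (use uv in auto)
  qed
  then show ?thesis using that s by blast
qed

text \<open>
  From here on, exceptional sets are null sets of \<^const>\<open>hausdorff_measure\<close>, so that they are Borel and
  countable unions stay null.
\<close>
lemma null_sets_hausdorff_measure:
  "N \<in> null_sets (hausdorff_measure m) \<longleftrightarrow> N \<in> sets borel \<and> hausdorff m N = 0"
  by (auto simp: null_sets_def emeasure_hausdorff_measure)

lemma convex_hull_null_sets: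
  fixes S :: "'a::real_normed_vector set"
  assumes "finite S" "card S \<le> m" "1 \<le> m"
  shows "convex hull S \<in> null_sets (hausdorff_measure m)"
proof -
  have "convex hull S \<in> sets borel"
    using assms(1) by (intro borel_closed compact_imp_closed finite_imp_compact_convex_hull)
  then show ?thesis
    using hausdorff_hull_null[OF assms] by (simp add: null_sets_hausdorff_measure)
qed

context coordinatized_map
begin

lemma image_cone_facet_null_sets:
  assumes "length \<tau> = m" "s \<in> set \<tau>"
  shows "image_cone (set \<tau> - {s}) \<in> null_sets (hausdorff_measure m)"
  unfolding image_cone_def
proof (rule convex_hull_null_sets[OF _ _ m])
  have "card (insert 0 (\<pi> ` (set \<tau> - {s}))) \<le> Suc (card (set \<tau> - {s}))"
    by (intro order_trans[OF card_insert_le_m1]) (auto intro!: card_image_le simp: card_insert_if)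
  also have "\<dots> = card (set \<tau>)" by (rule card_Suc_Diff1[OF finite_set assms(2)])
  also have "\<dots> \<le> m" using card_length[of \<tau>] assms(1) by simp
  finally show "card (insert 0 (\<pi> ` (set \<tau> - {s}))) \<le> m" .
qed simp

text \<open>
  All pieces have the sign of \<open>\<sigma>\<close>, and the cone over \<open>\<sigma>\<close> is the union of the cones over the pieces.
  If \<open>x\<close> lies in the cones over two pieces, then the ray through \<open>x\<close> hits the intersection of these
  pieces.  Being a face of both, the intersection is a proper face of at least one of them, so \<open>x\<close>
  lies in a cone over fewer than \<open>m\<close> points, and these cones are null.
\<close>
lemma crossing_partition:
  assumes part: "simplicial_partition (m - 1) \<sigma> T"
  shows "\<exists>N\<in>null_sets (hausdorff_measure m). \<forall>x. x \<notin> N \<longrightarrow> (\<Sum>\<tau>\<in>T. crossing x \<tau> g) = crossing x \<sigma> g"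
proof -
  have T: "finite T" and \<sigma>: "length \<sigma> = m"
    and inj: "inj_on simplex_hull T"
    and un: "(\<Union>\<tau>\<in>T. simplex_hull \<tau>) = simplex_hull \<sigma>"
    and face: "\<And>\<tau> \<tau>'. \<tau> \<in> T \<Longrightarrow> \<tau>' \<in> T \<Longrightarrow> (simplex_hull \<tau> \<inter> simplex_hull \<tau>') face_of simplex_hull \<tau>"
    and \<tau>: "\<And>\<tau>. \<tau> \<in> T \<Longrightarrow> length \<tau> = m"
    and ori: "\<And>\<tau>. \<tau> \<in> T \<Longrightarrow> same_orientation (m - 1) \<sigma> \<tau>"
    using part m by (auto simp: simplicial_partition_def oriented_simplex_def)
  have ne: "set \<tau> \<noteq> {}" "\<tau> ! 0 \<in> simplex_hull \<tau>" if "length \<tau> = m" for \<tau> :: "'a list"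
  proof -
    have "0 < length \<tau>" using that m by linarith
    then show "set \<tau> \<noteq> {}" "\<tau> ! 0 \<in> simplex_hull \<tau>" by (auto intro!: hull_inc)
  qed
  have sgn: "signed (vdet \<tau>) g = signed (vdet \<sigma>) g" if t: "\<tau> \<in> T" for \<tau>
  proof -
    obtain A where A: "edge_transition (m - 1) \<sigma> \<tau> A" "0 < Determinant.det A"
      using ori[OF t] by (auto simp: same_orientation_def)
    have "\<tau> ! 0 \<in> simplex_hull \<sigma>" using ne(2)[OF \<tau>[OF t]] un t by blast
    from vdet_transition_hull[OF \<sigma> A(1) this] show ?thesis
      using A(2) by (simp add: signed_mult_pos)
  qed
  show ?thesis
  proof (cases "vdet \<sigma> = 0")
    case True
    then have "crossing x \<tau> g = 0" if "\<tau> \<in> T" for \<tau> x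
      using sgn[OF that] by (simp add: crossing_def)
    then have "(\<Sum>\<tau>\<in>T. crossing x \<tau> g) = crossing x \<sigma> g" for x
      using True by (simp add: crossing_def[of x \<sigma>])
    then show ?thesis by (intro bexI[of _ "{}"]) auto
  next
    case False
    define N where "N = insert 0 (\<Union>\<tau>\<in>T. \<Union>s\<in>set \<tau>. image_cone (set \<tau> - {s}))"
    have "convex hull {0} \<in> null_sets (hausdorff_measure m :: 'a measure)"
      using m by (intro convex_hull_null_sets) auto
    then have 1: "{0} \<in> null_sets (hausdorff_measure m :: 'a measure)" by simp
    have "(\<Union>s\<in>set \<tau>. image_cone (set \<tau> - {s})) \<in> null_sets (hausdorff_measure m)" if "\<tau> \<in> T" for \<tau>
      using image_cone_facet_null_sets[OF \<tau>[OF that]] by (rule null_sets_UN'[OF countable_finite[OF finite_set]])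
    then have 2: "(\<Union>\<tau>\<in>T. \<Union>s\<in>set \<tau>. image_cone (set \<tau> - {s})) \<in> null_sets (hausdorff_measure m)"
      by (rule null_sets_UN'[OF countable_finite[OF T]])
    have N: "N \<in> null_sets (hausdorff_measure m)"
      unfolding N_def using null_sets.Un[OF 1 2] by simp
    have "(\<Sum>\<tau>\<in>T. crossing x \<tau> g) = crossing x \<sigma> g" if x: "x \<notin> N" for x
    proof -
      have x0: "x \<noteq> 0" using x by (auto simp: N_def)
      have facet: "x \<notin> image_cone (set \<tau> - {s})" if "\<tau> \<in> T" "s \<in> set \<tau>" for \<tau> s
        using x that by (auto simp: N_def)
      have disj: "\<tau> = \<tau>'" if t: "\<tau> \<in> T" "\<tau>' \<in> T" and c: "x \<in> image_cone (set \<tau>)" "x \<in> image_cone (set \<tau>')" for \<tau> \<tau>'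
      proof (rule ccontr)
        assume neq: "\<tau> \<noteq> \<tau>'"
        obtain r y r' y' where y: "0 \<le> r" "r \<le> 1" "y \<in> simplex_hull \<tau>" "x = r *\<^sub>R \<pi> y"
          and y': "y' \<in> simplex_hull \<tau>'" "x = r' *\<^sub>R \<pi> y'"
          using c ne \<tau> t by (auto simp: mem_image_cone_iff)
        have "y \<in> simplex_hull \<sigma>" "y' \<in> simplex_hull \<sigma>"
          using y y' un t by blast+
        then have "y = y'"
          by (rule ray_hits_once[OF \<sigma> False, of y y' r r']) (use y(4) y'(2) x0 in auto)
        define F where "F = simplex_hull \<tau> \<inter> simplex_hull \<tau>'"
        have yF: "y \<in> F" using y y' \<open>y = y'\<close> by (simp add: F_def)
        have "simplex_hull \<tau> \<noteq> simplex_hull \<tau>'" using inj neq t by (auto dest: inj_onD)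
        then obtain \<rho> where \<rho>: "\<rho> \<in> T" "F \<noteq> simplex_hull \<rho>" "F face_of simplex_hull \<rho>"
          using face[OF t] face[OF t(2,1)] t by (metis F_def Int_commute)
        then obtain s where s: "s \<in> set \<rho>" "F \<subseteq> convex hull (set \<rho> - {s})"
          using proper_face_subset_facet[of "set \<rho>" F] by auto
        then have "y \<in> convex hull (set \<rho> - {s})" using yF by blast
        moreover from this have "set \<rho> - {s} \<noteq> {}" by (metis convex_hull_empty empty_iff)
        ultimately have "x \<in> image_cone (set \<rho> - {s})"
          using y by (auto simp: mem_image_cone_iff)
        then show False using facet \<rho> s by blast
      qed
      have un_cone: "x \<in> image_cone (set \<sigma>) \<longleftrightarrow> (\<exists>\<tau>\<in>T. x \<in> image_cone (set \<tau>))"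
        using ne \<sigma> \<tau> un[symmetric] by (auto simp: mem_image_cone_iff)
      show ?thesis
      proof (cases "x \<in> image_cone (set \<sigma>)")
        case True
        then obtain \<tau> where t: "\<tau> \<in> T" "x \<in> image_cone (set \<tau>)" using un_cone by blast
        have "(\<Sum>\<tau>'\<in>T. crossing x \<tau>' g) = (\<Sum>\<tau>'\<in>{\<tau>}. crossing x \<tau>' g)"
          using T t disj by (intro sum.mono_neutral_right) (auto simp: crossing_def)
        then show ?thesis using True t by (simp add: crossing_def sgn)
      next
        case out: False
        then have "crossing x \<tau> g = 0" if "\<tau> \<in> T" for \<tau>
          using that un_cone by (auto simp: crossing_def)
        then show ?thesis using out by (simp add: crossing_def)
      qed
    qed
    then show ?thesis using N by blast
  qed
qed

section \<open>Crossing numbers of chains\<close>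

definition crossing_chain :: "'a \<Rightarrow> ('a list \<Rightarrow>\<^sub>0 'g::ab_group_add) \<Rightarrow> 'g" where
  "crossing_chain x b = (\<Sum>\<tau>\<in>Poly_Mapping.keys b. crossing x \<tau> (Poly_Mapping.lookup b \<tau>))"

lemma crossing_0 [simp]: "crossing x \<tau> 0 = 0"
  by (simp add: crossing_def)

lemma crossing_add: "crossing x \<tau> (g + h) = crossing x \<tau> g + crossing x \<tau> h"
  by (simp add: crossing_def signed_add)

lemma crossing_chain_single [simp]: "crossing_chain x (Poly_Mapping.single \<tau> g) = crossing x \<tau> g"
  by (cases "g = 0") (auto simp: crossing_chain_def)

lemma crossing_chain_add: "crossing_chain x (a + b) = crossing_chain x a + crossing_chain x b"
proof -
  let ?K = "Poly_Mapping.keys a \<union> Poly_Mapping.keys b"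
  have *: "crossing_chain x e = (\<Sum>\<tau>\<in>?K. crossing x \<tau> (Poly_Mapping.lookup e \<tau>))"
    if "Poly_Mapping.keys e \<subseteq> ?K" for e :: "'a list \<Rightarrow>\<^sub>0 'b::ab_group_add"
    unfolding crossing_chain_def using that
    by (intro sum.mono_neutral_left) (auto simp: in_keys_iff)
  show ?thesis
    using Poly_Mapping.keys_add[of a b] by (simp add: * lookup_add crossing_add sum.distrib)
qed

lemma crossing_chain_0 [simp]: "crossing_chain x 0 = 0"
  by (simp add: crossing_chain_def)

lemma crossing_chain_diff: "crossing_chain x (a - b) = crossing_chain x a - crossing_chain x b"
  using crossing_chain_add[of x "a - b" b] by (simp add: algebra_simps)

lemma crossing_chain_sum: "crossing_chain x (\<Sum>i\<in>I. f i) = (\<Sum>i\<in>I. crossing_chain x (f i))"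
  by (induction I rule: infinite_finite_induct) (simp_all add: crossing_chain_add)

text \<open>
  The exceptional set depends on \<open>b\<close>: each of the finitely many partitions used to write \<open>b\<close> as a
  combination of relations contributes a null set.
\<close>
lemma crossing_chain_relations:
  assumes "b \<in> chain_relations (m - 1)"
  shows "\<exists>N\<in>null_sets (hausdorff_measure m). \<forall>x. x \<notin> N \<longrightarrow> crossing_chain x b = 0"
  using assms unfolding chain_relations_def
proof (induction rule: group_closure.induct)
  case (base b)
  consider "b = 0"
    | \<sigma> \<tau> g where "b = Poly_Mapping.single \<tau> (- g) - Poly_Mapping.single \<sigma> g" "opposite_simplex (m - 1) \<sigma> \<tau>"
    | \<sigma> T g where "b = Poly_Mapping.single \<sigma> g - (\<Sum>\<tau>\<in>T. Poly_Mapping.single \<tau> g)"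
      "simplicial_partition (m - 1) \<sigma> T"
    using base by auto
  then show ?case
  proof cases
    case 1
    then show ?thesis by (intro bexI[of _ "{}"]) auto
  next
    case 2
    then show ?thesis
      by (intro bexI[of _ "{}"]) (auto simp: crossing_chain_diff crossing_opposite)
  next
    case 3
    obtain N where "N \<in> null_sets (hausdorff_measure m)"
      "\<forall>x. x \<notin> N \<longrightarrow> (\<Sum>\<tau>\<in>T. crossing x \<tau> g) = crossing x \<sigma> g"
      using crossing_partition[OF 3(2)] by blast
    then show ?thesis
      by (intro bexI[of _ N]) (auto simp: 3(1) crossing_chain_diff crossing_chain_sum)
  qed
next
  case (diff a b)
  then obtain N M where "N \<in> null_sets (hausdorff_measure m)" "\<forall>x. x \<notin> N \<longrightarrow> crossing_chain x a = 0"
    "M \<in> null_sets (hausdorff_measure m)" "\<forall>x. x \<notin> M \<longrightarrow> crossing_chain x b = 0" by blast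
  then show ?case
    by (intro bexI[of _ "N \<union> M"]) (auto simp: crossing_chain_diff)
qed

section \<open>The crossing number of a boundary\<close>

text \<open>
  The determinant of the \<open>m + 1\<close> vectors \<open>(1, \<pi> \<sigma>\<^sub>j)\<close>, expanded along the row of ones.
\<close>
definition orientation :: "'a list \<Rightarrow> real" where
  "orientation \<sigma> = (\<Sum>j\<le>m. (-1) ^ j * vdet (take j \<sigma> @ drop (Suc j) \<sigma>))"

text \<open>
  The row of ones in the matrix of the vectors \<open>(1, \<pi> \<sigma>\<^sub>j)\<close> is replaced by an arbitrary row \<open>f\<close>: with
  \<open>f = 1\<close> the determinant is the orientation, and with a row of coordinates it is \<open>0\<close>.
\<close>
lemma det_bordered:
  assumes \<sigma>: "length \<sigma> = Suc m"
  shows "Determinant.det (Matrix.mat (Suc m) (Suc m) (\<lambda>(i, j). if i = 0 then f j else c (\<sigma> ! j) (i - 1)))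
    = (\<Sum>j\<le>m. (-1) ^ j * vdet (take j \<sigma> @ drop (Suc j) \<sigma>) * f j)" (is "Determinant.det ?P = _")
proof -
  have "Determinant.det ?P = (\<Sum>j<Suc m. ?P $$ (0, j) * cofactor ?P 0 j)"
    by (rule laplace_expansion_row) auto
  also have "\<dots> = (\<Sum>j<Suc m. (-1) ^ j * vdet (take j \<sigma> @ drop (Suc j) \<sigma>) * f j)"
  proof (rule sum.cong)
    fix j assume "j \<in> {..<Suc m}"
    then have j: "j < Suc m" by simp
    have "mat_delete ?P 0 j = Matrix.mat m m (\<lambda>(i, l). c ((take j \<sigma> @ drop (Suc j) \<sigma>) ! l) i)"
    proof (rule eq_matI)
      fix i l assume "i < dim_row (Matrix.mat m m (\<lambda>(i, l). c ((take j \<sigma> @ drop (Suc j) \<sigma>) ! l) i))"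
        "l < dim_col (Matrix.mat m m (\<lambda>(i, l). c ((take j \<sigma> @ drop (Suc j) \<sigma>) ! l) i))"
      then have il: "i < m" "l < m" by simp_all
      show "mat_delete ?P 0 j $$ (i, l) =
          Matrix.mat m m (\<lambda>(i, l). c ((take j \<sigma> @ drop (Suc j) \<sigma>) ! l) i) $$ (i, l)"
        using il j \<sigma> nth_take_drop_Suc[of j \<sigma> l] by (simp add: mat_delete_def)
    qed (auto simp: mat_delete_def)
    then show "?P $$ (0, j) * cofactor ?P 0 j = (-1) ^ j * vdet (take j \<sigma> @ drop (Suc j) \<sigma>) * f j"
      using j by (simp add: cofactor_def vdet_def)
  qed simp
  finally show ?thesis by (simp add: lessThan_Suc_atMost)
qed

text \<open>
  Cramer's rule: in each coordinate the sum is the expansion of a determinant with two equal rows.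
\<close>
lemma minors_dependency:
  assumes \<sigma>: "length \<sigma> = Suc m"
  shows "(\<Sum>j\<le>m. ((-1) ^ j * vdet (take j \<sigma> @ drop (Suc j) \<sigma>)) *\<^sub>R \<pi> (\<sigma> ! j)) = 0"
proof -
  have "c (\<Sum>j\<le>m. ((-1) ^ j * vdet (take j \<sigma> @ drop (Suc j) \<sigma>)) *\<^sub>R \<sigma> ! j) r = 0" if r: "r < m" for r
  proof -
    let ?P = "Matrix.mat (Suc m) (Suc m) (\<lambda>(i, j). if i = 0 then c (\<sigma> ! j) r else c (\<sigma> ! j) (i - 1))"
    have "Determinant.det ?P = 0"
      by (rule det_identical_rows[of _ "Suc m" 0 "Suc r"]) (use r in \<open>auto simp: row_def\<close>)
    then show ?thesis by (simp add: coord_sum det_bordered[OF \<sigma>])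
  qed
  then have "\<pi> (\<Sum>j\<le>m. ((-1) ^ j * vdet (take j \<sigma> @ drop (Suc j) \<sigma>)) *\<^sub>R \<sigma> ! j) = 0"
    using coord_eq_0 by blast
  then show ?thesis by (simp only: map_sum)
qed

text \<open>
  The kernel of the matrix with columns \<open>(1, \<pi> \<sigma>\<^sub>j)\<close> consists of the affine dependencies of the
  points \<open>\<pi> \<sigma>\<^sub>j\<close>.
\<close>
lemma orientation_nonzero_iff:
  assumes \<sigma>: "length \<sigma> = Suc m"
  shows "orientation \<sigma> \<noteq> 0 \<longleftrightarrow>
    (\<forall>u. (\<Sum>j\<le>m. u j) = 0 \<longrightarrow> (\<Sum>j\<le>m. u j *\<^sub>R \<pi> (\<sigma> ! j)) = 0 \<longrightarrow> (\<forall>j\<le>m. u j = 0))"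
proof -
  let ?P = "Matrix.mat (Suc m) (Suc m) (\<lambda>(i, j). if i = 0 then 1 else c (\<sigma> ! j) (i - 1))"
  have det: "orientation \<sigma> = Determinant.det ?P"
    by (simp add: orientation_def det_bordered[OF \<sigma>, of "\<lambda>_. 1"])
  have ker: "?P *\<^sub>v v = 0\<^sub>v (Suc m) \<longleftrightarrow>
      (\<Sum>j\<le>m. v $ j) = 0 \<and> (\<Sum>j\<le>m. v $ j *\<^sub>R \<pi> (\<sigma> ! j)) = 0" if v: "v \<in> carrier_vec (Suc m)" for v
  proof -
    have "?P *\<^sub>v v = 0\<^sub>v (Suc m) \<longleftrightarrow> (\<forall>i<Suc m. (\<Sum>j\<le>m. ?P $$ (i, j) * v $ j) = 0)"
    proof -
      have "(?P *\<^sub>v v) $ i = (\<Sum>j\<le>m. ?P $$ (i, j) * v $ j)" if "i < Suc m" for i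
        using that v by (simp add: scalar_prod_def atLeast0LessThan lessThan_Suc_atMost)
      then show ?thesis by (simp add: vec_eq_iff)
    qed
    also have "\<dots> \<longleftrightarrow> (\<Sum>j\<le>m. v $ j) = 0 \<and> (\<forall>i<m. (\<Sum>j\<le>m. v $ j * c (\<sigma> ! j) i) = 0)"
      by (simp add: All_less_Suc2 mult.commute)
    also have "\<dots> \<longleftrightarrow> (\<Sum>j\<le>m. v $ j) = 0 \<and> (\<Sum>j\<le>m. v $ j *\<^sub>R \<pi> (\<sigma> ! j)) = 0"
      using coord_eq_0[of "\<Sum>j\<le>m. v $ j *\<^sub>R \<sigma> ! j"] by (simp add: coord_sum map_sum)
    finally show ?thesis .
  qed
  have "orientation \<sigma> = 0 \<longleftrightarrow> (\<exists>v. v \<in> carrier_vec (Suc m) \<and> v \<noteq> 0\<^sub>v (Suc m) \<and> ?P *\<^sub>v v = 0\<^sub>v (Suc m))"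
    unfolding det by (rule det_0_iff_vec_prod_zero_field) simp
  also have "\<dots> \<longleftrightarrow> (\<exists>u. (\<Sum>j\<le>m. u j) = 0 \<and> (\<Sum>j\<le>m. u j *\<^sub>R \<pi> (\<sigma> ! j)) = 0 \<and> (\<exists>j\<le>m. u j \<noteq> 0))"
  proof
    assume "\<exists>v. v \<in> carrier_vec (Suc m) \<and> v \<noteq> 0\<^sub>v (Suc m) \<and> ?P *\<^sub>v v = 0\<^sub>v (Suc m)"
    then obtain v where v: "v \<in> carrier_vec (Suc m)" "v \<noteq> 0\<^sub>v (Suc m)" "?P *\<^sub>v v = 0\<^sub>v (Suc m)" by blast
    have "\<exists>j\<le>m. v $ j \<noteq> 0" using v(1,2) by (auto simp: vec_eq_iff less_Suc_eq_le)
    then show "\<exists>u. (\<Sum>j\<le>m. u j) = 0 \<and> (\<Sum>j\<le>m. u j *\<^sub>R \<pi> (\<sigma> ! j)) = 0 \<and> (\<exists>j\<le>m. u j \<noteq> 0)"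
      using v(3) ker[OF v(1)] by blast
  next
    assume "\<exists>u. (\<Sum>j\<le>m. u j) = 0 \<and> (\<Sum>j\<le>m. u j *\<^sub>R \<pi> (\<sigma> ! j)) = 0 \<and> (\<exists>j\<le>m. u j \<noteq> 0)"
    then obtain u where u: "(\<Sum>j\<le>m. u j) = 0" "(\<Sum>j\<le>m. u j *\<^sub>R \<pi> (\<sigma> ! j)) = 0" "\<exists>j\<le>m. u j \<noteq> 0" by blast
    let ?v = "Matrix.vec (Suc m) u"
    have "?v \<noteq> 0\<^sub>v (Suc m)" using u(3) by (auto simp: vec_eq_iff less_Suc_eq_le)
    moreover have "?P *\<^sub>v ?v = 0\<^sub>v (Suc m)"
      using u by (subst ker) auto
    ultimately show "\<exists>v. v \<in> carrier_vec (Suc m) \<and> v \<noteq> 0\<^sub>v (Suc m) \<and> ?P *\<^sub>v v = 0\<^sub>v (Suc m)"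
      by (intro exI[of _ ?v]) simp
  qed
  finally show ?thesis by blast
qed

end

lemma convex_hull_subset_facets:
  fixes p :: "'i \<Rightarrow> 'a::real_vector"
  assumes I: "finite I" and v: "sum v I = 0" "(\<Sum>i\<in>I. v i *\<^sub>R p i) = 0" "\<exists>i\<in>I. v i \<noteq> 0"
  shows "convex hull (p ` I) \<subseteq> (\<Union>k\<in>I. convex hull (p ` (I - {k})))"
proof
  fix x assume "x \<in> convex hull (p ` I)"
  then obtain u where u: "\<forall>i\<in>I. 0 \<le> u i" "sum u I = 1" "(\<Sum>i\<in>I. u i *\<^sub>R p i) = x"
    using I by (auto simp: convex_hull_indexed_finite)
  have "\<exists>k\<in>I. v k < 0"
  proof (rule ccontr)
    assume "\<not> (\<exists>k\<in>I. v k < 0)"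
    then have "\<forall>i\<in>I. v i = 0" using v(1) sum_nonneg_eq_0_iff[OF I, of v] by (auto simp: not_less)
    then show False using v(3) by blast
  qed
  then obtain t k where t: "k \<in> I" "u k + t * v k = 0" "\<forall>i\<in>I. 0 \<le> u i + t * v i"
    using push_to_facet[OF I u(1), of v] by metis
  let ?w = "\<lambda>i. u i + t * v i"
  have "sum ?w I = 1" using u v by (simp add: sum.distrib flip: sum_distrib_left)
  moreover have "(\<Sum>i\<in>I. ?w i *\<^sub>R p i) = (\<Sum>i\<in>I. u i *\<^sub>R p i) + t *\<^sub>R (\<Sum>i\<in>I. v i *\<^sub>R p i)"
    by (simp add: scaleR_left_distrib sum.distrib scaleR_sum_right)
  moreover have "sum ?w (I - {k}) = sum ?w I" "(\<Sum>i\<in>I - {k}. ?w i *\<^sub>R p i) = (\<Sum>i\<in>I. ?w i *\<^sub>R p i)"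
    using I t by (auto intro!: sum.mono_neutral_left)
  ultimately have "sum ?w (I - {k}) = 1" "(\<Sum>i\<in>I - {k}. ?w i *\<^sub>R p i) = x"
    using u v by simp_all
  moreover have "\<forall>i\<in>I - {k}. 0 \<le> ?w i" using t(3) by simp
  ultimately have "\<exists>w. (\<forall>i\<in>I - {k}. 0 \<le> w i) \<and> sum w (I - {k}) = 1 \<and> (\<Sum>i\<in>I - {k}. w i *\<^sub>R p i) = x"
    by (intro exI[of _ ?w] conjI)
  then have "x \<in> convex hull (p ` (I - {k}))"
    by (simp only: convex_hull_indexed_finite[OF finite_Diff[OF I]] mem_Collect_eq)
  then show "x \<in> (\<Union>k\<in>I. convex hull (p ` (I - {k})))" using t(1) by blast
qed

context coordinatized_map
begin

lemma image_simplex_hull: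
  "length \<sigma> = Suc m \<Longrightarrow> \<pi> ` simplex_hull \<sigma> = convex hull ((\<lambda>j. \<pi> (\<sigma> ! j)) ` {..m})"
proof -
  assume "length \<sigma> = Suc m"
  then have "set \<sigma> = (!) \<sigma> ` {..m}" by (auto simp: set_conv_nth image_iff less_Suc_eq_le)
  then show ?thesis by (simp add: convex_hull_linear_image[OF linear_map] image_image)
qed

text \<open>
  The vertices of the image are affinely dependent, so the image is covered by the hulls of \<open>m\<close> of
  them.
\<close>
lemma orientation_0_null_image:
  assumes \<sigma>: "length \<sigma> = Suc m" and or: "orientation \<sigma> = 0"
  shows "hausdorff m (\<pi> ` simplex_hull \<sigma>) = 0"
proof -
  let ?p = "\<lambda>j. \<pi> (\<sigma> ! j)"
  let ?U = "\<Union>k\<in>{..m}. convex hull (?p ` ({..m} - {k}))"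
  obtain u where u: "(\<Sum>j\<le>m. u j) = 0" "(\<Sum>j\<le>m. u j *\<^sub>R ?p j) = 0" "\<exists>j\<le>m. u j \<noteq> 0"
    using orientation_nonzero_iff[OF \<sigma>] or by blast
  have sub: "convex hull (?p ` {..m}) \<subseteq> ?U"
    by (rule convex_hull_subset_facets) (use u in auto)
  have "convex hull (?p ` ({..m} - {k})) \<in> null_sets (hausdorff_measure m)" if "k \<in> {..m}" for k
  proof (rule convex_hull_null_sets[OF _ _ m])
    show "card (?p ` ({..m} - {k})) \<le> m"
      using that by (intro order_trans[OF card_image_le]) auto
  qed simp
  then have "?U \<in> null_sets (hausdorff_measure m)"
    by (rule null_sets_UN'[OF countable_finite[OF finite_atMost]])
  then have "hausdorff m ?U = 0"
    unfolding null_sets_hausdorff_measure by (rule conjunct2)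
  then show ?thesis
    using hausdorff_mono[OF sub, of m] by (simp add: image_simplex_hull[OF \<sigma>])
qed

text \<open>
  The facets of the configuration \<open>\<pi> \<sigma>\<^sub>0, \<dots>, \<pi> \<sigma>\<^sub>m, 0\<close> are the cones over the faces of \<open>\<pi>(\<sigma>)\<close> and
  \<open>\<pi>(\<sigma>)\<close> itself, which is opposite to the apex.  The signed minors, with minus their sum as the
  weight of the apex, form an affine dependency, so the crossings of the facets cancel.
\<close>
lemma crossing_boundary:
  assumes \<sigma>: "length \<sigma> = Suc m"
  shows "\<exists>N\<in>null_sets (hausdorff_measure m). \<forall>x. x \<notin> N \<longrightarrow>
    crossing_chain x (simplex_boundary \<sigma> g) =
      (if x \<in> \<pi> ` simplex_hull \<sigma> then signed (orientation \<sigma>) g else 0)"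
proof -
  define I where "I = {..Suc m}"
  define face where "face j = take j \<sigma> @ drop (Suc j) \<sigma>" for j
  define p where "p j = (if j \<le> m then \<pi> (\<sigma> ! j) else 0)" for j
  define d where "d j = (if j \<le> m then (-1) ^ j * vdet (face j) else - orientation \<sigma>)" for j
  have I: "finite I" "I = insert (Suc m) {..m}" by (auto simp: I_def)
  have sum_I: "(\<Sum>i\<in>I. f i) = (\<Sum>i\<le>m. f i) + f (Suc m)" for f :: "nat \<Rightarrow> 'c::comm_monoid_add"
    by (simp add: I_def)
  have sum_p: "(\<Sum>i\<in>I. u i *\<^sub>R p i) = (\<Sum>i\<le>m. u i *\<^sub>R \<pi> (\<sigma> ! i))" for u
    by (simp add: sum_I p_def)
  have d0: "sum d I = 0" by (simp add: sum_I d_def orientation_def face_def)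
  have dp: "(\<Sum>i\<in>I. d i *\<^sub>R p i) = 0"
    using minors_dependency[OF \<sigma>] by (simp add: sum_p d_def face_def)
  have unique: "\<forall>i\<in>I. u i = 0"
    if j: "j \<in> I" "d j \<noteq> 0" and u: "sum u I = 0" "(\<Sum>i\<in>I. u i *\<^sub>R p i) = 0" "u j = 0" for j u
  proof -
    have "\<forall>i\<le>m. u i = 0"
    proof (cases "j \<le> m")
      case True
      \<comment> \<open>The position in \<open>\<sigma>\<close> of the vertex number \<open>i\<close> of the face opposite to \<open>\<sigma>\<^sub>j\<close>.\<close>
      let ?s = "\<lambda>i. if i < j then i else Suc i"
      have face_nth: "face j ! i = \<sigma> ! ?s i" if "i < m" for i
        using nth_take_drop_Suc[of j \<sigma> i] \<sigma> that True by (simp add: face_def)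
      have "(\<Sum>i<m. u (?s i) *\<^sub>R \<pi> (face j ! i)) = (\<Sum>i<m. u (?s i) *\<^sub>R \<pi> (\<sigma> ! ?s i))"
        by (intro sum.cong) (auto simp: face_nth)
      also have "\<dots> = (\<Sum>i\<in>{..m} - {j}. u i *\<^sub>R \<pi> (\<sigma> ! i))"
        by (rule sum.reindex_bij_betw[OF bij_betw_skip[OF True]])
      also have "\<dots> = (\<Sum>i\<le>m. u i *\<^sub>R \<pi> (\<sigma> ! i))"
        using u(3) by (intro sum.mono_neutral_left) auto
      also have "\<dots> = 0" using u(2) by (simp add: sum_p)
      finally have z: "u (?s i) = 0" if "i < m" for i
        using vdet_nonzero_independent[of "face j" "\<lambda>i. u (?s i)" i] j True that by (simp add: d_def)
      show ?thesis
      proof (intro allI impI)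
        fix i assume i: "i \<le> m"
        show "u i = 0"
        proof (cases "i = j")
          case False
          then obtain l where "l < m" "i = ?s l"
            using bij_betw_imp_surj_on[OF bij_betw_skip[OF True]] i by blast
          then show ?thesis using z[of l] by simp
        qed (use u(3) in simp)
      qed
    next
      case False
      then have js: "j = Suc m" using j(1) by (simp add: I_def)
      then have "orientation \<sigma> \<noteq> 0" using j(2) by (simp add: d_def)
      then show ?thesis
        using orientation_nonzero_iff[OF \<sigma>] u js by (simp add: sum_I p_def)
    qed
    moreover from this have "u (Suc m) = 0" using u(1) by (simp add: sum_I)
    ultimately show ?thesis by (auto simp: I_def le_Suc_eq)
  qed
  \<comment> \<open>The faces of codimension two are hulls of \<open>m\<close> points.\<close>
  define N where "N = (\<Union>i\<in>I. \<Union>j\<in>I - {i}. convex hull (p ` (I - {i, j})))"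
  have "convex hull (p ` (I - {i, j})) \<in> null_sets (hausdorff_measure m)"
    if "i \<in> I" "j \<in> I - {i}" for i j
  proof (rule convex_hull_null_sets[OF _ _ m])
    have "card (I - {i, j}) = m" using that by (simp add: I_def)
    then show "card (p ` (I - {i, j})) \<le> m" using card_image_le[of "I - {i, j}" p] I by simp
  qed (use I in simp)
  then have N: "N \<in> null_sets (hausdorff_measure m)"
    unfolding N_def using I by (intro null_sets_UN'[OF countable_finite]) auto
  have "crossing_chain x (simplex_boundary \<sigma> g) =
      (if x \<in> \<pi> ` simplex_hull \<sigma> then signed (orientation \<sigma>) g else 0)" if x: "x \<notin> N" for x
  proof -
    have term_j: "crossing x (face j) (if even j then g else - g) =
        (if x \<in> convex hull (p ` (I - {j})) then signed (d j) g else 0)" if j: "j \<le> m" for j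
    proof -
      have "I - {j} = insert (Suc m) ({..<Suc m} - {j})" using j by (auto simp: I_def)
      then have "p ` (I - {j}) = insert 0 (p ` ({..<Suc m} - {j}))"
        by (simp only: image_insert) (simp add: p_def[of "Suc m"])
      also have "p ` ({..<Suc m} - {j}) = (\<lambda>i. \<pi> (\<sigma> ! i)) ` ({..<Suc m} - {j})"
        by (intro image_cong) (auto simp: p_def)
      also have "\<dots> = \<pi> ` set (face j)"
        unfolding face_def using j \<sigma> by (subst set_take_drop_Suc) (simp_all only: image_image)
      finally have "image_cone (set (face j)) = convex hull (p ` (I - {j}))" by (simp add: image_cone_def)
      then show ?thesis using j by (simp add: crossing_def d_def signed_minus)
    qed
    have "crossing_chain x (simplex_boundary \<sigma> g) =
        (\<Sum>j\<le>m. crossing x (face j) (if even j then g else - g))"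
      by (simp add: simplex_boundary_def crossing_chain_sum \<sigma> lessThan_Suc_atMost face_def)
    also have "\<dots> = (\<Sum>j\<le>m. if x \<in> convex hull (p ` (I - {j})) then signed (d j) g else 0)"
      by (intro sum.cong term_j) auto
    finally have eq: "crossing_chain x (simplex_boundary \<sigma> g) = \<dots>" .
    have "(\<Sum>j\<in>I. if x \<in> convex hull (p ` (I - {j})) then signed (d j) g else 0) = 0"
      by (rule line_crosses_facets_in_pairs[OF I(1) d0 dp unique]) (use x in \<open>auto simp: N_def\<close>)
    then have "crossing_chain x (simplex_boundary \<sigma> g) +
        (if x \<in> convex hull (p ` (I - {Suc m})) then signed (d (Suc m)) g else 0) = 0"
      by (simp add: sum_I eq)
    moreover have "p ` (I - {Suc m}) = (\<lambda>j. \<pi> (\<sigma> ! j)) ` {..m}"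
      unfolding I(2) by (auto simp: p_def)
    ultimately show ?thesis
      by (simp add: image_simplex_hull[OF \<sigma>] d_def signed_minus split: if_splits)
  qed
  then show ?thesis using N by blast
qed

section \<open>The triangle inequality for the image of a cycle\<close>

lemma chain_boundary_sum_single:
  "chain_boundary (\<Sum>k\<in>K. Poly_Mapping.single (\<sigma> k) (g k)) = (\<Sum>k\<in>K. simplex_boundary (\<sigma> k) (g k))"
  by (induction K rule: infinite_finite_induct) (simp_all add: chain_boundary_add, simp_all add: chain_boundary_def)

text \<open>
  The crossing number of the boundary of the chain is computed twice: it is \<open>0\<close> because the boundary
  is a combination of relations, and it is the sum of the signed indicators of the images.
\<close>
lemma image_cycle_vanishes:
  assumes K: "finite K" and \<sigma>: "\<And>k. k \<in> K \<Longrightarrow> length (\<sigma> k) = Suc m"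
    and cycle: "chain_equiv (m - 1) (chain_boundary (\<Sum>k\<in>K. Poly_Mapping.single (\<sigma> k) (g k))) 0"
  shows "AE x in hausdorff_measure m.
    (\<Sum>k\<in>K. if x \<in> \<pi> ` simplex_hull (\<sigma> k) then signed (orientation (\<sigma> k)) (g k) else 0) = 0"
proof -
  have "(\<Sum>k\<in>K. simplex_boundary (\<sigma> k) (g k)) \<in> chain_relations (m - 1)"
    using cycle by (simp add: chain_equiv_def chain_boundary_sum_single)
  from crossing_chain_relations[OF this] obtain N where
    N: "N \<in> null_sets (hausdorff_measure m)"
      "\<And>x. x \<notin> N \<Longrightarrow> (\<Sum>k\<in>K. crossing_chain x (simplex_boundary (\<sigma> k) (g k))) = 0"
    by (auto simp: crossing_chain_sum)
  have "AE x in hausdorff_measure m. crossing_chain x (simplex_boundary (\<sigma> k) (g k)) =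
      (if x \<in> \<pi> ` simplex_hull (\<sigma> k) then signed (orientation (\<sigma> k)) (g k) else 0)" if k: "k \<in> K" for k
  proof -
    obtain M where M: "M \<in> null_sets (hausdorff_measure m)" "\<forall>x. x \<notin> M \<longrightarrow>
        crossing_chain x (simplex_boundary (\<sigma> k) (g k)) =
        (if x \<in> \<pi> ` simplex_hull (\<sigma> k) then signed (orientation (\<sigma> k)) (g k) else 0)"
      using crossing_boundary[OF \<sigma>[OF k]] by blast
    show ?thesis using AE_not_in[OF M(1)] by eventually_elim (rule M(2)[rule_format])
  qed
  then have "AE x in hausdorff_measure m. \<forall>k\<in>K. crossing_chain x (simplex_boundary (\<sigma> k) (g k)) =
      (if x \<in> \<pi> ` simplex_hull (\<sigma> k) then signed (orientation (\<sigma> k)) (g k) else 0)"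
    by (intro AE_finite_allI K)
  moreover have "AE x in hausdorff_measure m. (\<Sum>k\<in>K. crossing_chain x (simplex_boundary (\<sigma> k) (g k))) = 0"
    using AE_not_in[OF N(1)] by eventually_elim (rule N(2))
  ultimately show ?thesis
    by eventually_elim (simp cong: sum.cong)
qed

text \<open>
  If the orientation of \<open>\<sigma> i\<close> is not \<open>0\<close>, then almost every point of its image satisfies
  \<open>\<plusminus>g i = - \<Sum>\<^sub>k \<plusminus>g k\<close>, the sum extending over some of the \<open>k\<close> whose image contains the point.
  Otherwise the image of \<open>\<sigma> i\<close> is null.
\<close>
lemma triangle_inequality_image:
  fixes nrm :: "'g::ab_group_add \<Rightarrow> real"
  assumes nrm: "normed_ab_group nrm" and K: "finite K" "i \<notin> K"
    and \<sigma>: "\<And>k. k \<in> insert i K \<Longrightarrow> length (\<sigma> k) = Suc m"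
    and cycle: "chain_equiv (m - 1) (chain_boundary (\<Sum>k\<in>insert i K. Poly_Mapping.single (\<sigma> k) (g k))) 0"
  shows "ennreal (nrm (g i)) * hausdorff m (\<pi> ` simplex_hull (\<sigma> i)) \<le>
    (\<Sum>k\<in>K. ennreal (nrm (g k)) * hausdorff m (\<pi> ` simplex_hull (\<sigma> k)))"
proof (cases "orientation (\<sigma> i) = 0")
  case True
  then show ?thesis using orientation_0_null_image[OF \<sigma>, of i] by simp
next
  case False
  let ?P = "\<lambda>k. \<pi> ` simplex_hull (\<sigma> k)"
  have n0: "nrm 0 = 0" and nm: "nrm (- a) = nrm a" and nt: "nrm (a + b) \<le> nrm a + nrm b" for a b
    using nrm by (auto simp: normed_ab_group_def)
  have nn: "0 \<le> nrm a" for a using nt[of a "- a"] by (simp add: n0 nm)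
  have nsum: "nrm (\<Sum>k\<in>J. f k) \<le> (\<Sum>k\<in>J. nrm (f k))" for f and J :: "'b set"
    by (induction J rule: infinite_finite_induct) (auto simp: n0 intro: order_trans[OF nt])
  have borel: "?P k \<in> sets borel" if "k \<in> insert i K" for k
    unfolding image_simplex_hull[OF \<sigma>[OF that]]
    by (intro borel_closed compact_imp_closed finite_imp_compact_convex_hull) simp
  have em: "emeasure (hausdorff_measure m) (?P k) = hausdorff m (?P k)" if "k \<in> insert i K" for k
    by (rule emeasure_hausdorff_measure[OF borel[OF that]])
  have "AE x in hausdorff_measure m. ennreal (nrm (g i)) * indicator (?P i) x \<le>
      (\<Sum>k\<in>K. ennreal (nrm (g k)) * indicator (?P k) x)"
  proof -
    have "AE x in hausdorff_measure m.
        (\<Sum>k\<in>insert i K. if x \<in> ?P k then signed (orientation (\<sigma> k)) (g k) else 0) = 0"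
      by (rule image_cycle_vanishes) (use K \<sigma> cycle in auto)
    then show ?thesis
    proof eventually_elim
      case (elim x)
      let ?h = "\<lambda>k. if x \<in> ?P k then signed (orientation (\<sigma> k)) (g k) else 0"
      have "?h i = - (\<Sum>k\<in>K. ?h k)" using elim K by (simp add: eq_neg_iff_add_eq_0)
      then have "nrm (?h i) \<le> (\<Sum>k\<in>K. nrm (?h k))" using nsum[of ?h K] by (simp only: nm)
      also have "\<dots> \<le> (\<Sum>k\<in>K. nrm (g k) * indicator (?P k) x)"
        by (intro sum_mono) (auto simp: signed_def nm n0 nn)
      finally have "nrm (g i) * indicator (?P i) x \<le> (\<Sum>k\<in>K. nrm (g k) * indicator (?P k) x)"
        using False by (auto simp: signed_def nm n0 indicator_def intro: sum_nonneg nn split: if_splits)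
      then have "ennreal (nrm (g i) * indicator (?P i) x) \<le> ennreal (\<Sum>k\<in>K. nrm (g k) * indicator (?P k) x)"
        by (rule ennreal_leI)
      then show ?case
        using nn by (simp add: sum_ennreal[symmetric] ennreal_mult ennreal_indicator)
    qed
  qed
  then have "(\<integral>\<^sup>+x. ennreal (nrm (g i)) * indicator (?P i) x \<partial>hausdorff_measure m) \<le>
      (\<integral>\<^sup>+x. (\<Sum>k\<in>K. ennreal (nrm (g k)) * indicator (?P k) x) \<partial>hausdorff_measure m)"
    by (rule nn_integral_mono_AE)
  also have "\<dots> = (\<Sum>k\<in>K. \<integral>\<^sup>+x. ennreal (nrm (g k)) * indicator (?P k) x \<partial>hausdorff_measure m)"
    using borel by (intro nn_integral_sum) auto
  also have "\<dots> = (\<Sum>k\<in>K. ennreal (nrm (g k)) * hausdorff m (?P k))"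
    using borel em by (intro sum.cong) (auto simp: nn_integral_cmult_indicator)
  finally show ?thesis
    using borel em by (simp add: nn_integral_cmult_indicator)
qed

end

section \<open>Integration over a density contractor\<close>

lemma exists_coordinates:
  fixes f :: "'a::real_normed_vector \<Rightarrow> 'a"
  assumes f: "linear f" and fin: "finite B0" "span B0 = (UNIV :: 'a set)"
    and rank: "dim (range f) \<le> m" and m: "1 \<le> m"
  shows "\<exists>c. coordinatized_map m f c"
proof -
  obtain B where B: "B \<subseteq> range f" "independent B" "range f \<subseteq> span B" "card B = dim (range f)"
    using basis_exists by metis
  have finB: "finite B"
    using independent_span_bound[OF fin(1) B(2)] fin(2) by simp
  obtain h where h: "bij_betw h {..<card B} B"
    using ex_bij_betw_nat_finite[OF finB] by (auto simp: atLeast0LessThan)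
  have inB: "f v \<in> span B" for v using B(3) by blast
  define c where "c v i = (if i < card B then representation B (f v) (h i) else 0)" for v i
  have "coordinatized_map m f c"
  proof (rule coordinatized_map.intro)
    show "1 \<le> m" by (rule m)
    show "linear f" by (rule f)
    show "linear (\<lambda>v. c v i)" for i
      by (rule linearI) (simp_all add: c_def linear_add[OF f] linear_cmul[OF f]
          representation_add[OF B(2) inB inB] representation_scale[OF B(2) inB])
    show "(\<forall>i<m. c v i = 0) \<longleftrightarrow> f v = 0" for v
    proof
      assume *: "\<forall>i<m. c v i = 0"
      have "representation B (f v) b = 0" if b: "b \<in> B" for b
      proof -
        obtain i where i: "i < card B" "b = h i" using h b by (auto simp: bij_betw_def)
        then have "c v i = 0" using * B(4) rank by simp
        then show ?thesis using i by (simp add: c_def)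
      qed
      then show "f v = 0"
        using sum_representation_eq[OF B(2) inB finB order_refl, of v] by simp
    qed (simp add: c_def representation_zero)
  qed
  then show ?thesis by blast
qed

lemma simplex_hull_translate_grassmannian:
  fixes \<sigma> :: "'a::real_normed_vector list"
  assumes "oriented_simplex m \<sigma>"
  shows "\<exists>V\<in>grassmannian m. \<exists>a A. A \<subseteq> V \<and> compact A \<and> simplex_hull \<sigma> = (+) a ` A"
proof -
  obtain a \<tau> where \<sigma>: "\<sigma> = a # \<tau>" "length \<tau> = m" "a \<notin> set \<tau>" "distinct \<tau>" "\<not> affine_dependent (insert a (set \<tau>))"
    using assms by (cases \<sigma>) (auto simp: oriented_simplex_def)
  define E where "E = (\<lambda>x. x - a) ` set \<tau>"
  have "independent E"
    using \<sigma>(3,5) affine_dependent_iff_dependent[of a "set \<tau>"] by (simp add: E_def setcompr_eq_image image_def)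
  moreover have "card E = m"
    using \<sigma> by (simp add: E_def card_image inj_on_def distinct_card)
  ultimately have V: "span E \<in> grassmannian m"
    by (simp add: grassmannian_def dim_eq_card_independent)
  let ?A = "convex hull (insert 0 E)"
  have "?A \<subseteq> span E"
    by (rule hull_minimal) (auto intro: span_base span_zero subspace_imp_convex)
  moreover have "compact ?A"
    by (rule finite_imp_compact_convex_hull) (simp add: E_def)
  moreover have "simplex_hull \<sigma> = (+) a ` ?A"
    by (simp add: convex_hull_translation[symmetric] \<sigma>(1) E_def image_image)
  ultimately show ?thesis using V by blast
qed

text \<open>
  A simplex lies in a translate of a linear subspace.  Linear maps commute with translations up to a
  translation, and Hausdorff measure is translation invariant, so the conditions for subsets of linear
  subspaces carry over.
\<close>
lemma density_contractor_simplex: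
  fixes \<sigma> :: "'a::real_normed_vector list"
  assumes \<mu>: "density_contractor m W \<mu>" and A: "A \<subseteq> V" "compact A" "V \<in> grassmannian m"
    and hull: "simplex_hull \<sigma> = (+) a ` A"
  shows "(\<integral>\<^sup>+\<pi>. hausdorff m (blinfun_apply \<pi> ` simplex_hull \<sigma>) \<partial>\<mu>) \<le> hausdorff m (simplex_hull \<sigma>)"
    and "V = W \<Longrightarrow> (\<integral>\<^sup>+\<pi>. hausdorff m (blinfun_apply \<pi> ` simplex_hull \<sigma>) \<partial>\<mu>) = hausdorff m (simplex_hull \<sigma>)"
proof -
  have "blinfun_apply \<pi> ` simplex_hull \<sigma> = (+) (blinfun_apply \<pi> a) ` blinfun_apply \<pi> ` A" for \<pi> :: "'a \<Rightarrow>\<^sub>L 'a"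
    by (simp add: hull image_image blinfun.add_right)
  then have image: "hausdorff m (blinfun_apply \<pi> ` simplex_hull \<sigma>) = hausdorff m (blinfun_apply \<pi> ` A)" for \<pi> :: "'a \<Rightarrow>\<^sub>L 'a"
    by (simp add: hausdorff_translation)
  have "A \<in> sets borel" using A(2) by (intro borel_closed compact_imp_closed)
  then have "(\<integral>\<^sup>+\<pi>. hausdorff m (blinfun_apply \<pi> ` A) \<partial>\<mu>) \<le> hausdorff m A"
    and "V = W \<Longrightarrow> (\<integral>\<^sup>+\<pi>. hausdorff m (blinfun_apply \<pi> ` A) \<partial>\<mu>) = hausdorff m A"
    using \<mu> A(1,3) unfolding density_contractor_def by blast+
  then show "(\<integral>\<^sup>+\<pi>. hausdorff m (blinfun_apply \<pi> ` simplex_hull \<sigma>) \<partial>\<mu>) \<le> hausdorff m (simplex_hull \<sigma>)"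
    and "V = W \<Longrightarrow> (\<integral>\<^sup>+\<pi>. hausdorff m (blinfun_apply \<pi> ` simplex_hull \<sigma>) \<partial>\<mu>) = hausdorff m (simplex_hull \<sigma>)"
    by (simp_all only: image) (simp_all only: hull hausdorff_translation)
qed

theorem theorem5p4:
  fixes m :: nat and nrm :: "'g::ab_group_add \<Rightarrow> real"
  assumes "\<exists>B. finite B \<and> span B = (UNIV :: 'a::real_normed_vector set)"
    and "m \<in> {1..dim (UNIV :: 'a set) - 1}"
    and "\<forall>W \<in> grassmannian m. \<exists>\<mu>. density_contractor m (W :: 'a set) \<mu>"
    and "complete_normed_ab_group nrm"
  shows "triangle_inequality_for_cycles TYPE('a) nrm m"
  unfolding triangle_inequality_for_cycles_def
proof (intro allI impI)
  fix \<kappa> :: nat and \<sigma> :: "nat \<Rightarrow> 'a list" and g :: "nat \<Rightarrow> 'g"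
  assume \<kappa>: "1 \<le> \<kappa>" and \<sigma>: "\<forall>k\<in>{1..\<kappa>}. oriented_simplex m (\<sigma> k)"
    and cycle: "chain_equiv (m - 1) (chain_boundary (\<Sum>k=1..\<kappa>. Poly_Mapping.single (\<sigma> k) (g k))) 0"
  have nrm: "normed_ab_group nrm"
    using assms(4) by (simp add: complete_normed_ab_group_def)
  have m: "1 \<le> m" using assms(2) by simp
  obtain B0 :: "'a set" where B0: "finite B0" "span B0 = UNIV" using assms(1) by blast
  have split: "{1..\<kappa>} = insert 1 {2..\<kappa>}" using \<kappa> by auto
  have len: "length (\<sigma> k) = Suc m" if "k \<in> insert 1 {2..\<kappa>}" for k
  proof -
    have "k \<in> {1..\<kappa>}" using that split by blast
    then show ?thesis using \<sigma> by (simp add: oriented_simplex_def)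
  qed
  let ?H = "\<lambda>k. hausdorff m (simplex_hull (\<sigma> k))"
  let ?F = "\<lambda>k \<pi>. hausdorff m (blinfun_apply \<pi> ` simplex_hull (\<sigma> k))"
  have plane: "\<exists>V\<in>grassmannian m. \<exists>a A. A \<subseteq> V \<and> compact A \<and> simplex_hull (\<sigma> k) = (+) a ` A"
    if "k \<in> {1..\<kappa>}" for k
    using simplex_hull_translate_grassmannian \<sigma> that by blast
  obtain W a A where W: "W \<in> grassmannian m" "A \<subseteq> W" "compact A" "simplex_hull (\<sigma> 1) = (+) a ` A"
    using plane[of 1] \<kappa> by auto
  obtain \<mu> where \<mu>: "density_contractor m W \<mu>" using assms(3) W(1) by blast
  have sets_\<mu>: "sets \<mu> = sets (restrict_space borel (Hom_rank_le m))"
    using \<mu> by (simp add: density_contractor_def)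
  then have space_\<mu>: "space \<mu> = Hom_rank_le m"
    using sets_eq_imp_space_eq[OF sets_\<mu>] by (simp add: space_restrict_space)
  have meas: "?F k \<in> borel_measurable \<mu>" for k
  proof -
    have "?F k \<in> borel_measurable borel"
      by (intro measurable_hausdorff_blinfun_image finite_imp_compact_convex_hull) simp
    then have "?F k \<in> borel_measurable (restrict_space borel (Hom_rank_le m))"
      by (rule measurable_restrict_space1)
    then show ?thesis using sets_\<mu> by (simp cong: measurable_cong_sets)
  qed
  have pointwise: "ennreal (nrm (g 1)) * ?F 1 \<pi> \<le> (\<Sum>k=2..\<kappa>. ennreal (nrm (g k)) * ?F k \<pi>)"
    if "\<pi> \<in> space \<mu>" for \<pi>
  proof -
    have "dim (range (blinfun_apply \<pi>)) \<le> m"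
      using that by (simp add: space_\<mu> Hom_rank_le_def)
    then obtain c where c: "coordinatized_map m (blinfun_apply \<pi>) c"
      using exists_coordinates[OF bounded_linear.linear[OF blinfun.bounded_linear_right] B0 _ m]
      by blast
    have cycle': "chain_equiv (m - 1)
        (chain_boundary (\<Sum>k\<in>insert 1 {2..\<kappa>}. Poly_Mapping.single (\<sigma> k) (g k))) 0"
      using cycle by (simp only: split)
    show ?thesis
      by (rule coordinatized_map.triangle_inequality_image[OF c nrm _ _ len cycle']) simp_all
  qed
  have "ennreal (nrm (g 1)) * ?H 1 = ennreal (nrm (g 1)) * (\<integral>\<^sup>+\<pi>. ?F 1 \<pi> \<partial>\<mu>)"
    using density_contractor_simplex(2)[OF \<mu> W(2,3,1,4)] by simp
  also have "\<dots> = (\<integral>\<^sup>+\<pi>. ennreal (nrm (g 1)) * ?F 1 \<pi> \<partial>\<mu>)"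
    by (intro nn_integral_cmult[symmetric] meas)
  also have "\<dots> \<le> (\<integral>\<^sup>+\<pi>. (\<Sum>k=2..\<kappa>. ennreal (nrm (g k)) * ?F k \<pi>) \<partial>\<mu>)"
    by (intro nn_integral_mono pointwise)
  also have "\<dots> = (\<Sum>k=2..\<kappa>. \<integral>\<^sup>+\<pi>. ennreal (nrm (g k)) * ?F k \<pi> \<partial>\<mu>)"
    by (intro nn_integral_sum borel_measurable_times_ennreal borel_measurable_const meas)
  also have "\<dots> = (\<Sum>k=2..\<kappa>. ennreal (nrm (g k)) * (\<integral>\<^sup>+\<pi>. ?F k \<pi> \<partial>\<mu>))"
    by (intro sum.cong refl nn_integral_cmult meas)
  also have "\<dots> \<le> (\<Sum>k=2..\<kappa>. ennreal (nrm (g k)) * ?H k)"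
  proof (intro sum_mono mult_left_mono)
    fix k assume "k \<in> {2..\<kappa>}"
    then have "k \<in> {1..\<kappa>}" by simp
    from plane[OF this] obtain V b C where "V \<in> grassmannian m" "C \<subseteq> V" "compact C"
      "simplex_hull (\<sigma> k) = (+) b ` C" by blast
    then show "(\<integral>\<^sup>+\<pi>. ?F k \<pi> \<partial>\<mu>) \<le> ?H k"
      using density_contractor_simplex(1)[OF \<mu>] by blast
  qed simp
  finally show "hausdorff_mass m nrm (Poly_Mapping.single (\<sigma> 1) (g 1)) \<le>
      (\<Sum>k=2..\<kappa>. hausdorff_mass m nrm (Poly_Mapping.single (\<sigma> k) (g k)))"
    by (simp add: hausdorff_mass_single[OF nrm])
qed

end
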